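(* Let $\kappa$ be a regular uncountable cardinal, and let $\xi\le\kappa$ be an ordinal, $\mu,\nu,\theta\le\kappa$ cardinals (or $\mu=\infty$), $\mathcal S$ a nonempty collection of stationary subsets of $\kappa$, and $\mathcal R$ a relation from the family $\mathfrak F$ described below. Suppose that $\clubsuit(\kappa)$ and $\mathrm P^-_\xi(\kappa,\mu,\mathcal R,\theta,\mathcal S,\nu,1)$ both hold. Then: (1) $\mathrm P^-_\xi(\kappa,\mu,\mathcal R,\theta,\mathcal S,\nu,{<}\omega)$ holds; (2) if $0<\theta<\omega$, then $\mathrm P^-_\xi(\kappa,\mu,\mathcal R,{<}\omega,\mathcal S,\nu,{<}\omega)$ holds.
   Context: Notation: for a set of ordinals $C$, $\mathrm{acc}(C):=\{\alpha\in C\mid\sup(C\cap\alpha)=\alpha>0\}$, $\mathrm{nacc}(C):=C\setminus\mathrm{acc}(C)$; for $j<\mathrm{otp}(C)$, $C(j)$ is the unique $\delta\in C$ with $\mathrm{otp}(C\cap\delta)=j$; for an ordinal $\sigma$, $\mathrm{succ}_\sigma(C):=\{C(j+1)\mid j<\sigma,\ j+1<\mathrm{otp}(C)\}$. $\mathrm{acc}(\kappa)$ is the set of nonzero limit ordinals below $\kappa$. $\mathcal K(\kappa)$ is the set of nonempty $x\subseteq\kappa$ such that $x$ is a club subset of $\sup(x)$ with $\sup(x)\notin x$; for $C\in\mathcal K(\kappa)$, $\alpha_C:=\sup(C)$. Relations on $\mathcal K(\kappa)$: $C\sqsubseteq D$ iff $C=D\cap\alpha_C$; $C\sqsubseteq^*D$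 iff there is $\gamma<\alpha_C$ with $C\setminus\gamma\sqsubseteq D\setminus\gamma$; for $\mathcal R'\in\{\sqsubseteq,\sqsubseteq^*\}$ and a cardinal $\chi$: $C\,{}_\chi\mathcal R'\,D$ iff ($C\,\mathcal R'\,D$ or $\mathrm{cf}(\alpha_C)<\chi$), and $C\,\mathcal R'_\chi\,D$ iff ($C\,\mathcal R'\,D$ or ($\mathrm{otp}(D)<\chi$ and $\mathrm{nacc}(D)$ consists only of successor ordinals)); for a relation $\mathcal R'$ and a class of ordinals $\Omega$, $C\,{}^\Omega\mathcal R'\,D$ iff ($C\,\mathcal R'\,D$ and $\alpha_C\notin\Omega$). The family $\mathfrak F$ consists of the relations $\sqsubseteq,\sqsubseteq^*,{}_\chi\sqsubseteq,{}_\chi\sqsubseteq^*,\sqsubseteq_\chi,\sqsubseteq^*_\chi$ (any cardinal $\chi$) and ${}^\Omega\mathcal R'$ for any such $\mathcal R'$ and any class $\Omega$. The principle $\mathrm P^-_\xi(\kappa,\mu,\mathcal R,\theta,\mathcal S,\nu,\sigma)$ asserts the existence of $\langle\mathcal C_\alpha\mid\alpha<\kappa\rangle$ (with $\mathcal C_0=\{\emptyset\}$, $\mathcal C_{\alpha+1}=\{\{\alpha\}\}$) such that for every $\alpha\in\mathrm{acc}(\kappa)$: $\mathcal C_\alpha\subseteq\{C\in\mathcal K(\kappa)\mid\mathrm{otp}(C)\le\xi,\ \alpha_C=\alpha\}$; $0<|\mathcal C_\alpha|<\mu$ (if $\mu=\infty$: $|\mathcal C_\alpha|\le|\alpha|$);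 and for all $C\in\mathcal C_\alpha$ and $\bar\alpha\in\mathrm{acc}(C)$ there is $D\in\mathcal C_{\bar\alpha}$ with $D\,\mathcal R\,C$; and moreover, for every sequence $\langle B_i\mid i<\theta\rangle$ of cofinal subsets of $\kappa$ and every $S\in\mathcal S$, there are stationarily many $\alpha\in S$ with $|\mathcal C_\alpha|<\nu$ such that for all $C\in\mathcal C_\alpha$ and $i<\min\{\alpha,\theta\}$: $\sup\{\gamma\in C\mid\mathrm{succ}_\sigma(C\setminus\gamma)\subseteq B_i\}=\alpha$. Writing ${<}\omega$ in place of $\sigma$ (resp. $\theta$) means that one sequence witnesses the principle simultaneously for all finite $\sigma'$ (resp. all $\theta'<\omega$). $\clubsuit(\kappa)$: there is $\langle X_\delta\mid\delta<\kappa\rangle$ with $X_\delta$ cofinal in $\delta$ of order-type $\mathrm{cf}(\delta)$ for limit $\delta$, such that for every cofinal $X\subseteq\kappa$, $\{\delta<\kappa\mid X_\delta\subseteq X\}$ is stationary. *)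

theory Defs
  imports "HOL-Library.Equipollence"
begin

text \<open>
  Ordinals are the elements of an arbitrary well-ordered type, an ordinal \<open>\<alpha>\<close> being identified with
  the set \<open>{..<\<alpha>}\<close> of its predecessors. The cardinal \<open>\<kappa>\<close> is an element of that type, so every ordinal
  up to and including \<open>\<kappa>\<close> is available. The operations below that are given by
  \<open>LEAST\<close> or \<open>THE\<close> are meant for arguments where the described ordinal exists: \<open>osucc \<alpha>\<close> for
  \<open>\<alpha>\<close> below some ordinal, and \<open>osup A\<close> and \<open>otp A\<close> for \<open>A\<close> bounded above.
\<close>

definition ozero :: "'o::wellorder" where
  "ozero = (LEAST \<beta>. True)"

definition osucc :: "'o::wellorder \<Rightarrow> 'o" where
  "osucc \<alpha> = (LEAST \<beta>. \<alpha> < \<beta>)"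

definition oone :: "'o::wellorder" where
  "oone = osucc ozero"

definition omega :: "'o::wellorder" where
  "omega = (LEAST \<beta>. infinite {..<\<beta>})"

definition is_succ :: "'o::wellorder \<Rightarrow> bool" where
  "is_succ \<beta> \<longleftrightarrow> (\<exists>\<gamma><\<beta>. \<beta> = osucc \<gamma>)"

definition osup :: "'o::wellorder set \<Rightarrow> 'o" where
  "osup A = (LEAST \<beta>. \<forall>a\<in>A. a \<le> \<beta>)"

definition otp :: "'o::wellorder set \<Rightarrow> 'o" where
  "otp A = (THE \<beta>. \<exists>f. bij_betw f {..<\<beta>} A \<and> strict_mono_on {..<\<beta>} f)"

definition is_cardinal :: "'o::wellorder \<Rightarrow> bool" where
  "is_cardinal \<alpha> \<longleftrightarrow> (\<forall>\<beta><\<alpha>. {..<\<beta>} \<prec> {..<\<alpha>})"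

definition cofinal_in :: "'o::wellorder set \<Rightarrow> 'o \<Rightarrow> bool" where
  "cofinal_in A \<delta> \<longleftrightarrow> A \<subseteq> {..<\<delta>} \<and> (\<forall>\<gamma><\<delta>. \<exists>a\<in>A. \<gamma> \<le> a)"

definition cf :: "'o::wellorder \<Rightarrow> 'o" where
  "cf \<delta> = (LEAST \<beta>. \<exists>A. cofinal_in A \<delta> \<and> otp A = \<beta>)"

definition regular_uncountable :: "'o::wellorder \<Rightarrow> bool" where
  "regular_uncountable \<kappa> \<longleftrightarrow> is_cardinal \<kappa> \<and> cf \<kappa> = \<kappa> \<and> uncountable {..<\<kappa>}"

definition club_in :: "'o::wellorder set \<Rightarrow> 'o \<Rightarrow> bool" where
  "club_in A \<delta> \<longleftrightarrow> cofinal_in A \<delta> \<and>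
     (\<forall>\<alpha><\<delta>. ozero < \<alpha> \<and> osup (A \<inter> {..<\<alpha>}) = \<alpha> \<longrightarrow> \<alpha> \<in> A)"

definition stationary_in :: "'o::wellorder set \<Rightarrow> 'o \<Rightarrow> bool" where
  "stationary_in S \<kappa> \<longleftrightarrow> S \<subseteq> {..<\<kappa>} \<and> (\<forall>E. club_in E \<kappa> \<longrightarrow> S \<inter> E \<noteq> {})"

definition acc :: "'o::wellorder set \<Rightarrow> 'o set" where
  "acc C = {\<alpha> \<in> C. osup (C \<inter> {..<\<alpha>}) = \<alpha> \<and> \<alpha> > ozero}"

definition nacc :: "'o::wellorder set \<Rightarrow> 'o set" where
  "nacc C = C - acc C"

definition elem_at :: "'o::wellorder set \<Rightarrow> 'o \<Rightarrow> 'o" where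
  "elem_at C j = (THE \<delta>. \<delta> \<in> C \<and> otp (C \<inter> {..<\<delta>}) = j)"

definition succ_set :: "'o::wellorder \<Rightarrow> 'o set \<Rightarrow> 'o set" where
  "succ_set \<sigma> C = {elem_at C (osucc j) | j. j < \<sigma> \<and> osucc j < otp C}"

definition KK :: "'o::wellorder \<Rightarrow> 'o set set" where
  "KK \<kappa> = {x. x \<noteq> {} \<and> x \<subseteq> {..<\<kappa>} \<and> club_in x (osup x) \<and> osup x \<notin> x}"

text \<open>
  The relations on \<open>KK \<kappa>\<close>, with \<open>osup C\<close> in the role of \<open>\<alpha>\<^sub>C\<close>. They are written as relations on all
  sets of ordinals; the principle applies them to members of \<open>KK \<kappa>\<close> only.
\<close>

definition end_ext :: "'o::wellorder set \<Rightarrow> 'o set \<Rightarrow> bool" where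
  "end_ext C D \<longleftrightarrow> C = D \<inter> {..<osup C}"

definition end_ext_star :: "'o::wellorder set \<Rightarrow> 'o set \<Rightarrow> bool" where
  "end_ext_star C D \<longleftrightarrow> (\<exists>\<gamma><osup C. end_ext (C - {..<\<gamma>}) (D - {..<\<gamma>}))"

definition left_chi ::
  "'o::wellorder \<Rightarrow> ('o set \<Rightarrow> 'o set \<Rightarrow> bool) \<Rightarrow> 'o set \<Rightarrow> 'o set \<Rightarrow> bool" where
  "left_chi \<chi> R C D \<longleftrightarrow> R C D \<or> cf (osup C) < \<chi>"

definition right_chi ::
  "'o::wellorder \<Rightarrow> ('o set \<Rightarrow> 'o set \<Rightarrow> bool) \<Rightarrow> 'o set \<Rightarrow> 'o set \<Rightarrow> bool" where
  "right_chi \<chi> R C D \<longleftrightarrow> R C D \<or> (otp D < \<chi> \<and> (\<forall>\<beta>\<in>nacc D. is_succ \<beta>))"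

definition omit ::
  "'o::wellorder set \<Rightarrow> ('o set \<Rightarrow> 'o set \<Rightarrow> bool) \<Rightarrow> 'o set \<Rightarrow> 'o set \<Rightarrow> bool" where
  "omit \<Omega> R C D \<longleftrightarrow> R C D \<and> osup C \<notin> \<Omega>"

inductive_set FF :: "('o::wellorder set \<Rightarrow> 'o set \<Rightarrow> bool) set" where
  "end_ext \<in> FF"
| "end_ext_star \<in> FF"
| "is_cardinal \<chi> \<Longrightarrow> left_chi \<chi> end_ext \<in> FF"
| "is_cardinal \<chi> \<Longrightarrow> left_chi \<chi> end_ext_star \<in> FF"
| "is_cardinal \<chi> \<Longrightarrow> right_chi \<chi> end_ext \<in> FF"
| "is_cardinal \<chi> \<Longrightarrow> right_chi \<chi> end_ext_star \<in> FF"
| "R \<in> FF \<Longrightarrow> omit \<Omega> R \<in> FF"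

text \<open>
  The parameter \<open>\<mu>\<close> is a cardinal \<open>Some m\<close> or \<open>None\<close>, which stands for \<open>\<infinity>\<close>.
  Note that \<open>acc {..<\<kappa>}\<close> is the set of nonzero limit ordinals below \<open>\<kappa>\<close>.
\<close>

definition card_bound :: "'o::wellorder option \<Rightarrow> 'o \<Rightarrow> 'o set set \<Rightarrow> bool" where
  "card_bound \<mu> \<alpha> F \<longleftrightarrow>
     (case \<mu> of None \<Rightarrow> F \<lesssim> {..<\<alpha>} | Some m \<Rightarrow> F \<prec> {..<m})"

definition P_coherent ::
  "'o::wellorder \<Rightarrow> 'o \<Rightarrow> 'o option \<Rightarrow> ('o set \<Rightarrow> 'o set \<Rightarrow> bool) \<Rightarrow> ('o \<Rightarrow> 'o set set) \<Rightarrow> bool" where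
  "P_coherent \<xi> \<kappa> \<mu> R \<C> \<longleftrightarrow>
     \<C> ozero = {{}} \<and>
     (\<forall>\<alpha><\<kappa>. \<C> (osucc \<alpha>) = {{\<alpha>}}) \<and>
     (\<forall>\<alpha>\<in>acc {..<\<kappa>}.
        \<C> \<alpha> \<subseteq> {C \<in> KK \<kappa>. otp C \<le> \<xi> \<and> osup C = \<alpha>} \<and>
        \<C> \<alpha> \<noteq> {} \<and> card_bound \<mu> \<alpha> (\<C> \<alpha>) \<and>
        (\<forall>C\<in>\<C> \<alpha>. \<forall>\<alpha>'\<in>acc C. \<exists>D\<in>\<C> \<alpha>'. R D C))"

definition P_hits ::
  "'o::wellorder \<Rightarrow> 'o \<Rightarrow> 'o set set \<Rightarrow> 'o \<Rightarrow> 'o \<Rightarrow> ('o \<Rightarrow> 'o set set) \<Rightarrow> bool" where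
  "P_hits \<kappa> \<theta> \<S> \<nu> \<sigma> \<C> \<longleftrightarrow>
     (\<forall>B. (\<forall>i<\<theta>. cofinal_in (B i) \<kappa>) \<longrightarrow>
       (\<forall>S\<in>\<S>. stationary_in
          {\<alpha> \<in> S. \<C> \<alpha> \<prec> {..<\<nu>} \<and>
             (\<forall>C\<in>\<C> \<alpha>. \<forall>i<min \<alpha> \<theta>.
                osup {\<gamma> \<in> C. succ_set \<sigma> (C - {..<\<gamma>}) \<subseteq> B i} = \<alpha>)} \<kappa>))"

definition P_minus ::
  "'o::wellorder \<Rightarrow> 'o \<Rightarrow> 'o option \<Rightarrow> ('o set \<Rightarrow> 'o set \<Rightarrow> bool) \<Rightarrow> 'o \<Rightarrow> 'o set set \<Rightarrow> 'o \<Rightarrow> 'o \<Rightarrow> bool"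
  where
  "P_minus \<xi> \<kappa> \<mu> R \<theta> \<S> \<nu> \<sigma> \<longleftrightarrow>
     (\<exists>\<C>. P_coherent \<xi> \<kappa> \<mu> R \<C> \<and> P_hits \<kappa> \<theta> \<S> \<nu> \<sigma> \<C>)"

text \<open>The principle with \<open><\<omega>\<close> in place of \<open>\<sigma>\<close>, and with \<open><\<omega>\<close> in place of both \<open>\<theta>\<close> and \<open>\<sigma>\<close>.\<close>

definition P_minus_fin_sigma ::
  "'o::wellorder \<Rightarrow> 'o \<Rightarrow> 'o option \<Rightarrow> ('o set \<Rightarrow> 'o set \<Rightarrow> bool) \<Rightarrow> 'o \<Rightarrow> 'o set set \<Rightarrow> 'o \<Rightarrow> bool"
  where
  "P_minus_fin_sigma \<xi> \<kappa> \<mu> R \<theta> \<S> \<nu> \<longleftrightarrow>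
     (\<exists>\<C>. P_coherent \<xi> \<kappa> \<mu> R \<C> \<and> (\<forall>\<sigma><omega. P_hits \<kappa> \<theta> \<S> \<nu> \<sigma> \<C>))"

definition P_minus_fin_theta_sigma ::
  "'o::wellorder \<Rightarrow> 'o \<Rightarrow> 'o option \<Rightarrow> ('o set \<Rightarrow> 'o set \<Rightarrow> bool) \<Rightarrow> 'o set set \<Rightarrow> 'o \<Rightarrow> bool"
  where
  "P_minus_fin_theta_sigma \<xi> \<kappa> \<mu> R \<S> \<nu> \<longleftrightarrow>
     (\<exists>\<C>. P_coherent \<xi> \<kappa> \<mu> R \<C> \<and> (\<forall>\<theta><omega. \<forall>\<sigma><omega. P_hits \<kappa> \<theta> \<S> \<nu> \<sigma> \<C>))"

definition clubsuit_principle :: "'o::wellorder \<Rightarrow> bool" where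
  "clubsuit_principle \<kappa> \<longleftrightarrow>
     (\<exists>X. (\<forall>\<delta>\<in>acc {..<\<kappa>}. cofinal_in (X \<delta>) \<delta> \<and> otp (X \<delta>) = cf \<delta>) \<and>
          (\<forall>Y. cofinal_in Y \<kappa> \<longrightarrow> stationary_in {\<delta>. \<delta> < \<kappa> \<and> X \<delta> \<subseteq> Y} \<kappa>))"

end

theory Submission
  imports Defs
begin

text \<open>
  Fix a coding of finite subsets of \<open>\<kappa>\<close> by ordinals below \<open>\<kappa>\<close>. Decoding a \<open>\<clubsuit>\<close>-sequence
  gives finite sets \<open>G \<beta> \<gamma> \<subseteq> (\<gamma>, \<beta>)\<close>, nonempty only for limit \<open>\<beta>\<close>, such that for every family \<open>\<F>\<close>
  containing finite sets arbitrarily high in \<open>\<kappa>\<close>, there are cofinally many \<open>\<beta>\<close> with \<open>G \<beta> \<gamma> \<in> \<F>\<close> for all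
  \<open>\<gamma> < \<beta>\<close>. Replace each \<open>C\<close> in the given sequence by \<open>fill C\<close>, which inserts \<open>G \<beta> \<gamma>\<close> between any two
  consecutive elements \<open>\<gamma> < \<beta>\<close> of \<open>C\<close>. This preserves accumulation points, does not increase the
  order type, and respects all relations in \<open>FF\<close>; for the relations \<open>right_chi\<close> this holds because nothing
  is inserted below a successor. Choosing \<open>\<F>\<close> to be the finite sets that contain blocks of
  \<open>n + 1\<close> consecutive elements from each of the prescribed cofinal sets, a single hit of the old
  sequence in the set of good \<open>\<beta>\<close> turns into such blocks in the new one.
\<close>

section \<open>Order types and limit points\<close>

text \<open>Names the witness hidden in \<open>otp\<close>, so that an order type can be computed by
  exhibiting a map.\<close>

definition enumerates :: "('o::wellorder \<Rightarrow> 'o) \<Rightarrow> 'o \<Rightarrow> 'o set \<Rightarrow> bool" where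
  "enumerates f \<beta> A \<longleftrightarrow> bij_betw f {..<\<beta>} A \<and> strict_mono_on {..<\<beta>} f"

lemma ozero_le: "ozero \<le> \<alpha>"
  unfolding ozero_def by (rule Least_le) simp

text \<open>If \<open>f x < x\<close>, then monotonicity gives \<open>f (f x) < f x\<close>, so
  \<open>f x\<close> would be a smaller counterexample.\<close>

lemma strict_mono_on_ge:
  fixes f :: "'o::wellorder \<Rightarrow> 'o"
  assumes "strict_mono_on {..<\<beta>} f" "x < \<beta>"
  shows "x \<le> f x"
  using assms(2)
proof (induction x rule: less_induct)
  case (less x)
  show ?case
  proof (rule ccontr)
    assume "\<not> x \<le> f x"
    then have "f x < x" by simp
    moreover from this less.prems have "f x < \<beta>" by simp
    ultimately have "f x \<le> f (f x)" "f (f x) < f x"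
      using less assms(1) by (auto simp: strict_mono_on_def)
    then show False by simp
  qed
qed

text \<open>Otherwise the inverse of \<open>f\<close> after \<open>g\<close> maps
  \<open>\<beta>'\<close> strictly increasingly into the smaller \<beta>, which is impossible at the
  argument \<beta>. Used in both directions, this makes the \<open>THE\<close> in \<open>otp\<close>
  unique.\<close>

lemma enumerates_le:
  assumes f: "enumerates f \<beta> A" and g: "enumerates g \<beta>' A"
  shows "\<beta>' \<le> \<beta>"
proof (rule ccontr)
  assume "\<not> \<beta>' \<le> \<beta>"
  then have lt: "\<beta> < \<beta>'" by simp
  define h where "h = inv_into {..<\<beta>} f \<circ> g"
  have fh: "f (h x) = g x" "h x < \<beta>" if "x < \<beta>'" for x
  proof -
    have "g x \<in> f ` {..<\<beta>}"
      using f g that by (auto simp: enumerates_def bij_betw_def)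
    then show "f (h x) = g x" "h x < \<beta>"
      unfolding h_def using inv_into_into[of "g x" f "{..<\<beta>}"]
      by (auto simp: f_inv_into_f)
  qed
  have "strict_mono_on {..<\<beta>'} h"
  proof (rule strict_mono_onI)
    fix x y assume xy: "x \<in> {..<\<beta>'}" "y \<in> {..<\<beta>'}" "x < y"
    then have "f (h x) < f (h y)"
      using fh g by (auto simp: enumerates_def strict_mono_on_def)
    moreover have "h y \<le> h x \<Longrightarrow> f (h y) \<le> f (h x)"
      using f fh(2) xy unfolding enumerates_def strict_mono_on_def
      by (metis lessThan_iff order_le_less)
    ultimately show "h x < h y" by force
  qed
  then have "\<beta> \<le> h \<beta>" using lt by (rule strict_mono_on_ge)
  with fh(2)[OF lt] show False by simp
qed

lemma otp_eq:
  assumes "enumerates f \<beta> A" shows "otp A = \<beta>"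
proof -
  have "otp A = (THE \<beta>. \<exists>f. enumerates f \<beta> A)"
    by (simp add: otp_def enumerates_def)
  also have "\<dots> = \<beta>"
    using assms enumerates_le by (blast intro: antisym)
  finally show ?thesis .
qed

lemma enumerates_restrict:
  assumes f: "enumerates f \<beta> A" and j: "j < \<beta>"
  shows "enumerates f j (A \<inter> {..<f j})"
proof -
  have mono: "f x < f y \<longleftrightarrow> x < y" if "x < \<beta>" "y < \<beta>" for x y
    using f that unfolding enumerates_def strict_mono_on_def
    by (metis lessThan_iff linorder_neq_iff order_less_asym)
  have "f ` {..<j} = A \<inter> {..<f j}"
  proof
    show "f ` {..<j} \<subseteq> A \<inter> {..<f j}"
      using f j mono by (auto simp: enumerates_def bij_betw_def)
    show "A \<inter> {..<f j} \<subseteq> f ` {..<j}"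
    proof
      fix x assume x: "x \<in> A \<inter> {..<f j}"
      then obtain i where "i < \<beta>" "x = f i" using f by (auto simp: enumerates_def bij_betw_def)
      with x mono j show "x \<in> f ` {..<j}" by auto
    qed
  qed
  moreover have "inj_on f {..<j}" "strict_mono_on {..<j} f"
    using f j unfolding enumerates_def bij_betw_def inj_on_def strict_mono_on_def
    by (auto dest: order_less_trans)
  ultimately show ?thesis by (simp add: enumerates_def bij_betw_def)
qed

text \<open>By induction each \<open>a < \<delta>\<close> has a rank \<open>r a\<close>, the order
  type of \<open>A\<close> below \<open>a\<close>. The ranks of the elements of \<open>A\<close>
  below \<delta> form an initial segment, and the inverse of \<open>r\<close> is the
  enumeration.\<close>

lemma enumerates_exists:
  fixes A :: "'o::wellorder set"
  shows "\<exists>f \<beta>. \<beta> \<le> \<delta> \<and> enumerates f \<beta> (A \<inter> {..<\<delta>})"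
proof (induction \<delta> rule: less_induct)
  case (less \<delta>)
  define r where "r a = otp (A \<inter> {..<a})" for a
  have ex: "\<exists>f. enumerates f (r a) (A \<inter> {..<a})" and le: "r a \<le> a" if a: "a < \<delta>" for a
  proof -
    obtain f \<beta> where "\<beta> \<le> a" "enumerates f \<beta> (A \<inter> {..<a})" using less[OF a] by blast
    moreover from this have "r a = \<beta>" by (simp add: r_def otp_eq)
    ultimately show "\<exists>f. enumerates f (r a) (A \<inter> {..<a})" "r a \<le> a" by auto
  qed
  have pos: "f j \<in> A \<and> f j < a \<and> r (f j) = j"
    if "enumerates f (r a) (A \<inter> {..<a})" "j < r a" for f a j
  proof -
    have m: "f j \<in> A" "f j < a" using that by (auto simp: enumerates_def bij_betw_def)
    have "enumerates f j (A \<inter> {..<a} \<inter> {..<f j})" using enumerates_restrict that by blast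
    moreover have "A \<inter> {..<a} \<inter> {..<f j} = A \<inter> {..<f j}" using m by auto
    ultimately have "r (f j) = j" by (simp add: r_def otp_eq)
    with m show ?thesis by simp
  qed
  have mono: "r a' < r a" if "a' \<in> A" "a' < a" "a < \<delta>" for a a'
  proof -
    obtain f where f: "enumerates f (r a) (A \<inter> {..<a})" using ex \<open>a < \<delta>\<close> by blast
    then have "f ` {..<r a} = A \<inter> {..<a}" by (simp add: enumerates_def bij_betw_def)
    then obtain j where "j < r a" "a' = f j" using \<open>a' \<in> A\<close> \<open>a' < a\<close> by blast
    with pos[OF f] show ?thesis by auto
  qed
  define \<beta> where "\<beta> = (LEAST b. b \<notin> r ` (A \<inter> {..<\<delta>}))"
  \<comment> \<open>Since \<open>r a \<le> a\<close>, the ordinal \<delta> is not a rank, which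
    gives the \<open>LEAST\<close> in \<beta> a witness. This is why the bound on the order type is
    carried through the induction.\<close>
  have not: "\<delta> \<notin> r ` (A \<inter> {..<\<delta>})" using le by fastforce
  have \<beta>: "\<beta> \<notin> r ` (A \<inter> {..<\<delta>})" unfolding \<beta>_def by (rule LeastI[of _ \<delta>]) (rule not)
  have "\<beta> \<le> \<delta>" unfolding \<beta>_def by (rule Least_le) (rule not)
  have img: "r ` (A \<inter> {..<\<delta>}) = {..<\<beta>}"
  proof
    show "{..<\<beta>} \<subseteq> r ` (A \<inter> {..<\<delta>})"
      unfolding \<beta>_def using not_less_Least by blast
    show "r ` (A \<inter> {..<\<delta>}) \<subseteq> {..<\<beta>}"
    proof
      fix j assume "j \<in> r ` (A \<inter> {..<\<delta>})"
      then obtain a where a: "a \<in> A" "a < \<delta>" "j = r a" by blast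
      show "j \<in> {..<\<beta>}"
      proof (rule ccontr)
        assume "j \<notin> {..<\<beta>}"
        then have "\<beta> < r a" using \<beta> a by (metis IntI image_eqI lessThan_iff linorder_neqE)
        moreover obtain f where "enumerates f (r a) (A \<inter> {..<a})" using ex a by blast
        ultimately have "f \<beta> \<in> A" "f \<beta> < a" "r (f \<beta>) = \<beta>" using pos by blast+
        with \<beta> a(2) show False by (metis IntI image_eqI lessThan_iff order_less_trans)
      qed
    qed
  qed
  have inj: "inj_on r (A \<inter> {..<\<delta>})"
    by (rule inj_onI) (metis IntD1 IntD2 lessThan_iff linorder_neqE mono order_less_irrefl)
  define f where "f = inv_into (A \<inter> {..<\<delta>}) r"
  have "bij_betw f {..<\<beta>} (A \<inter> {..<\<delta>})"
    unfolding f_def img[symmetric] using inj by (intro bij_betw_inv_into) (simp add: bij_betw_def)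
  moreover have "strict_mono_on {..<\<beta>} f"
  proof (rule strict_mono_onI)
    fix x y assume xy: "x \<in> {..<\<beta>}" "y \<in> {..<\<beta>}" "x < y"
    then have "r (f x) = x" "r (f y) = y" "f x \<in> A" "f y \<in> A" "f x < \<delta>" "f y < \<delta>"
      using inv_into_into[of _ r "A \<inter> {..<\<delta>}"] f_inv_into_f[of _ r "A \<inter> {..<\<delta>}"]
      unfolding f_def img by auto
    with xy mono show "f x < f y"
      by (metis linorder_neqE order_less_asym)
  qed
  ultimately show ?case using \<open>\<beta> \<le> \<delta>\<close> by (auto simp: enumerates_def)
qed

lemma enumerates_otp:
  assumes "A \<subseteq> {..<\<delta>}"
  obtains f where "enumerates f (otp A) A"
proof -
  have "A \<inter> {..<\<delta>} = A" using assms by blast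
  then obtain f \<beta> where "enumerates f \<beta> A" using enumerates_exists[of \<delta> A] by auto
  moreover from this have "otp A = \<beta>" by (rule otp_eq)
  ultimately show ?thesis using that by blast
qed

lemma otp_eqpoll:
  assumes "A \<subseteq> {..<\<delta>}" shows "{..<otp A} \<approx> A"
  using enumerates_otp[OF assms] by (metis enumerates_def eqpoll_def)

lemma otp_Int_less:
  assumes "A \<subseteq> {..<\<delta>}" "a \<in> A" shows "otp (A \<inter> {..<a}) < otp A"
proof -
  obtain f where f: "enumerates f (otp A) A" using enumerates_otp assms by blast
  then have "f ` {..<otp A} = A" by (simp add: enumerates_def bij_betw_def)
  then obtain j where "j < otp A" "a = f j" using assms by blast
  with otp_eq[OF enumerates_restrict[OF f]] show ?thesis by simp
qed

lemma elem_at_eq: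
  assumes "A \<subseteq> {..<\<delta>}" "a \<in> A" shows "elem_at A (otp (A \<inter> {..<a})) = a"
  unfolding elem_at_def
proof (rule the_equality)
  fix b assume b: "b \<in> A \<and> otp (A \<inter> {..<b}) = otp (A \<inter> {..<a})"
  have less: "otp (A \<inter> {..<x}) < otp (A \<inter> {..<y})" if "x \<in> A" "y \<in> A" "x < y" for x y
  proof -
    have "A \<inter> {..<y} \<inter> {..<x} = A \<inter> {..<x}" using that by auto
    then show ?thesis using otp_Int_less[of "A \<inter> {..<y}" y x] that by simp
  qed
  show "b = a"
    using less b assms by (metis linorder_neqE order_less_irrefl)
qed (use assms in simp)

lemma elem_at_mem:
  assumes "A \<subseteq> {..<\<delta>}" "j < otp A"
  shows "elem_at A j \<in> A" "otp (A \<inter> {..<elem_at A j}) = j"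
proof -
  obtain f where f: "enumerates f (otp A) A" using enumerates_otp assms by blast
  then have m: "f j \<in> A" using assms by (auto simp: enumerates_def bij_betw_def)
  have o: "otp (A \<inter> {..<f j}) = j" using otp_eq[OF enumerates_restrict[OF f assms(2)]] .
  have "elem_at A j = f j" using elem_at_eq[OF assms(1) m] o by simp
  with m o show "elem_at A j \<in> A" "otp (A \<inter> {..<elem_at A j}) = j" by simp_all
qed

section \<open>Successor ordinals and \<open>succ_set\<close>\<close>

text \<open>The ordinal \<beta> certifies that the type has an element above \<alpha>, so that the
  \<open>LEAST\<close> in \<open>osucc\<close> is attained.\<close>

lemma osucc_greater: "\<alpha> < \<beta> \<Longrightarrow> \<alpha> < osucc \<alpha>"
  unfolding osucc_def by (rule LeastI)

lemma osucc_le: "\<alpha> < \<beta> \<Longrightarrow> osucc \<alpha> \<le> \<beta>"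
  unfolding osucc_def by (rule Least_le)

lemma lessThan_osucc: "\<alpha> < \<beta> \<Longrightarrow> {..<osucc \<alpha>} = insert \<alpha> {..<\<alpha>}"
  using osucc_greater[of \<alpha> \<beta>] osucc_le[of \<alpha>] by auto (meson leD linorder_neqE)

lemma otp_singleton:
  fixes a :: "'o::wellorder"
  assumes "a < b"
  shows "otp {a} = oone"
proof -
  have "ozero < b" using ozero_le assms by (rule order_le_less_trans)
  moreover have "{..<ozero :: 'o} = {}" by (auto simp: leD[OF ozero_le])
  ultimately have one: "{..<oone :: 'o} = {ozero}"
    unfolding oone_def by (simp only: lessThan_osucc)
  have "enumerates (\<lambda>_. a) oone {a}"
    unfolding enumerates_def one bij_betw_def strict_mono_on_def by simp
  then show ?thesis by (rule otp_eq)
qed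

text \<open>Extracts what a hit of the original sequence says: \<open>oone\<close> is
  \<open>osucc ozero\<close>, and the entry of that index in \<open>C - {..<\<gamma>}\<close> is the
  next element of \<open>C\<close> after \<gamma>.\<close>

lemma succ_set_oone:
  fixes C :: "'o::wellorder set"
  assumes "C \<subseteq> {..<\<delta>}" "\<gamma> \<in> C" "\<beta> \<in> C" "\<gamma> < \<beta>" "C \<inter> {\<gamma><..<\<beta>} = {}"
  shows "\<beta> \<in> succ_set oone (C - {..<\<gamma>})"
proof -
  let ?E = "C - {..<\<gamma>}"
  have E: "?E \<subseteq> {..<\<delta>}" "\<beta> \<in> ?E" using assms by auto
  have "?E \<inter> {..<\<beta>} = {\<gamma>}" using assms by fastforce
  then have o: "otp (?E \<inter> {..<\<beta>}) = oone" using otp_singleton[OF assms(4)] by simp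
  have "oone < otp ?E" using otp_Int_less[OF E] o by simp
  moreover have "elem_at ?E oone = \<beta>" using elem_at_eq[OF E] o by simp
  moreover have "ozero < (oone :: 'o)"
    unfolding oone_def using osucc_greater[OF order_le_less_trans[OF ozero_le \<open>\<gamma> < \<beta>\<close>]] .
  ultimately show ?thesis
    unfolding succ_set_def by (auto simp: oone_def intro!: exI[of _ ozero])
qed

text \<open>A member has index \<open>osucc j \<le> \<sigma>\<close>, and the index counts its
  predecessors in \<open>E\<close>. So \<open>succ_set\<close> stays within the first
  \<open>card {..<\<sigma>} + 1\<close> elements of \<open>E\<close>.\<close>

lemma succ_set_card:
  assumes "E \<subseteq> {..<\<delta>}" "x \<in> succ_set \<sigma> E" "finite {..<\<sigma>}"
  shows "x \<in> E" "finite (E \<inter> {..<x})" "card (E \<inter> {..<x}) \<le> card {..<\<sigma>}"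
proof -
  obtain j where j: "x = elem_at E (osucc j)" "j < \<sigma>" "osucc j < otp E"
    using assms(2) by (auto simp: succ_set_def)
  note m = elem_at_mem[OF assms(1) j(3), folded j(1)]
  show "x \<in> E" by (rule m)
  have eq: "{..<osucc j} \<approx> E \<inter> {..<x}" using otp_eqpoll[of "E \<inter> {..<x}" x] m(2) by simp
  have sub: "{..<osucc j} \<subseteq> {..<\<sigma>}" using osucc_le[OF j(2)] by auto
  then have fin: "finite {..<osucc j}" using assms(3) finite_subset by blast
  with eq show "finite (E \<inter> {..<x})" using eqpoll_finite_iff by blast
  have "card (E \<inter> {..<x}) = card {..<osucc j}"
    using eq by (metis bij_betw_same_card eqpoll_def)
  then show "card (E \<inter> {..<x}) \<le> card {..<\<sigma>}" using card_mono[OF assms(3) sub] by simp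
qed

section \<open>Limit points, closed sets and membership in \<open>KK\<close>\<close>

text \<open>Unlike for \<open>acc\<close>, the point need not belong to the set, so that closedness
  can be expressed.\<close>

definition limit_point :: "'o::wellorder set \<Rightarrow> 'o \<Rightarrow> bool" where
  "limit_point A \<delta> \<longleftrightarrow> ozero < \<delta> \<and> (\<forall>\<epsilon><\<delta>. \<exists>x\<in>A. \<epsilon> < x \<and> x < \<delta>)"

lemma osup_eq_iff:
  assumes "S \<subseteq> {..\<delta>}"
  shows "osup S = \<delta> \<longleftrightarrow> (\<forall>\<epsilon><\<delta>. \<exists>x\<in>S. \<epsilon> < x)"
proof
  assume \<delta>: "osup S = \<delta>"
  show "\<forall>\<epsilon><\<delta>. \<exists>x\<in>S. \<epsilon> < x"
  proof (intro allI impI)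
    fix \<epsilon> assume "\<epsilon> < \<delta>"
    then have "\<not> (\<forall>a\<in>S. a \<le> \<epsilon>)" unfolding \<delta>[symmetric] osup_def by (rule not_less_Least)
    then show "\<exists>x\<in>S. \<epsilon> < x" by (auto simp: not_le)
  qed
next
  assume *: "\<forall>\<epsilon><\<delta>. \<exists>x\<in>S. \<epsilon> < x"
  show "osup S = \<delta>"
    unfolding osup_def
  proof (rule Least_equality)
    show "\<delta> \<le> \<beta>" if "\<forall>a\<in>S. a \<le> \<beta>" for \<beta> using * that by (meson leD leI)
  qed (use assms in auto)
qed

lemma osup_Int_iff: "osup (A \<inter> {..<\<delta>}) = \<delta> \<longleftrightarrow> (\<forall>\<epsilon><\<delta>. \<exists>x\<in>A. \<epsilon> < x \<and> x < \<delta>)"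
  by (subst osup_eq_iff) auto

lemma acc_eq: "acc A = {\<alpha> \<in> A. limit_point A \<alpha>}"
  by (auto simp: acc_def limit_point_def osup_Int_iff)

lemma club_in_iff:
  "club_in A \<delta> \<longleftrightarrow> cofinal_in A \<delta> \<and> (\<forall>\<alpha><\<delta>. limit_point A \<alpha> \<longrightarrow> \<alpha> \<in> A)"
  by (auto simp: club_in_def limit_point_def osup_Int_iff)

lemma osucc_not_limit_point: "\<alpha> < \<beta> \<Longrightarrow> \<not> limit_point A (osucc \<alpha>)"
  using osucc_greater[of \<alpha> \<beta>] osucc_le[of \<alpha>] unfolding limit_point_def by (meson leD)

lemma limit_cases:
  assumes "\<alpha> < (\<kappa> :: 'o::wellorder)"
  obtains "\<alpha> = ozero" | \<gamma> where "\<gamma> < \<alpha>" "\<alpha> = osucc \<gamma>" | "\<alpha> \<in> acc {..<\<kappa>}"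
proof -
  have "\<alpha> = osucc \<gamma>" if "\<gamma> < \<alpha>" "\<forall>x<\<alpha>. x \<le> \<gamma>" for \<gamma>
    using that osucc_le[of \<gamma> \<alpha>] osucc_greater[of \<gamma> \<alpha>] by (metis leD order_le_less)
  note succ = this
  show ?thesis
  proof (cases "\<exists>\<gamma><\<alpha>. \<forall>x<\<alpha>. x \<le> \<gamma>")
    case True
    with succ that(2) show ?thesis by blast
  next
    case False
    then have "\<alpha> \<in> acc {..<\<kappa>}" if "\<alpha> \<noteq> ozero"
      using that assms ozero_le[of \<alpha>] unfolding acc_eq limit_point_def
      by (auto simp: not_le) (meson lessThan_iff order_less_trans)
    with that show ?thesis by blast
  qed
qed

text \<open>An \<open>osup\<close>-free form of membership in \<open>KK\<close> with supremum
  \<alpha>. The strict inequality \<open>\<epsilon> < a\<close> and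
  \<open>C \<subseteq> {..<\<alpha>}\<close> together encode
  \<open>osup C \<notin> C\<close>.\<close>

definition unbounded_closed :: "'o::wellorder set \<Rightarrow> 'o \<Rightarrow> bool" where
  "unbounded_closed C \<alpha> \<longleftrightarrow> C \<noteq> {} \<and> C \<subseteq> {..<\<alpha>} \<and> (\<forall>\<epsilon><\<alpha>. \<exists>a\<in>C. \<epsilon> < a) \<and>
     (\<forall>\<delta><\<alpha>. limit_point C \<delta> \<longrightarrow> \<delta> \<in> C)"

lemma unbounded_closed_imp_osup: "unbounded_closed C \<alpha> \<Longrightarrow> osup C = \<alpha>"
  by (subst osup_eq_iff) (auto simp: unbounded_closed_def)

lemma KK_iff: "C \<in> KK \<kappa> \<and> osup C = \<alpha> \<longleftrightarrow> C \<subseteq> {..<\<kappa>} \<and> unbounded_closed C \<alpha>"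
proof
  assume *: "C \<in> KK \<kappa> \<and> osup C = \<alpha>"
  then have "C \<subseteq> {..\<alpha>}" by (auto simp: KK_def club_in_iff cofinal_in_def)
  then have "\<forall>\<epsilon><\<alpha>. \<exists>a\<in>C. \<epsilon> < a" using * osup_eq_iff by blast
  with * show "C \<subseteq> {..<\<kappa>} \<and> unbounded_closed C \<alpha>"
    by (auto simp: KK_def club_in_iff cofinal_in_def unbounded_closed_def)
next
  assume *: "C \<subseteq> {..<\<kappa>} \<and> unbounded_closed C \<alpha>"
  then have "osup C = \<alpha>" by (simp add: unbounded_closed_imp_osup)
  with * show "C \<in> KK \<kappa> \<and> osup C = \<alpha>"
    by (auto simp: KK_def club_in_iff cofinal_in_def unbounded_closed_def) (meson less_imp_le)
qed

text \<open>A finite set of this form would have a maximum, yet \<open>A\<close> has points between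
  that maximum and \<alpha>.\<close>

lemma limit_point_infinite:
  assumes "limit_point A \<alpha>" "\<delta> < \<alpha>"
  shows "infinite (A \<inter> {\<delta>..<\<alpha>})"
proof
  assume fin: "finite (A \<inter> {\<delta>..<\<alpha>})"
  have "A \<inter> {\<delta>..<\<alpha>} \<noteq> {}"
    using assms unfolding limit_point_def by (metis Int_iff atLeastLessThan_iff empty_iff less_imp_le)
  then have "Max (A \<inter> {\<delta>..<\<alpha>}) \<in> A \<inter> {\<delta>..<\<alpha>}" using Max_in[OF fin] by blast
  moreover from this obtain x where "x \<in> A" "Max (A \<inter> {\<delta>..<\<alpha>}) < x" "x < \<alpha>"
    using assms by (auto simp: limit_point_def)
  ultimately have "x \<in> A \<inter> {\<delta>..<\<alpha>}" by auto
  then have "x \<le> Max (A \<inter> {\<delta>..<\<alpha>})" using fin by simp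
  with \<open>Max (A \<inter> {\<delta>..<\<alpha>}) < x\<close> show False by simp
qed

text \<open>The candidate is the supremum \<open>s\<close> of \<open>D\<close> below
  \<open>d\<close>. It is not \<open>d\<close>, which is no limit point; and if it were missing from
  \<open>D\<close>, it would be a limit point of \<open>D\<close>, against closedness.\<close>

lemma closed_has_max:
  assumes closed: "\<forall>\<delta><\<alpha>. limit_point D \<delta> \<longrightarrow> \<delta> \<in> D"
    and "d \<le> \<alpha>" "D \<inter> {..<d} \<noteq> {}" "\<not> limit_point D d"
  obtains m where "m \<in> D" "m < d" "\<forall>x\<in>D. x < d \<longrightarrow> x \<le> m"
proof -
  define s where "s = (LEAST u. \<forall>x\<in>D. x < d \<longrightarrow> x \<le> u)"
  have ub: "\<forall>x\<in>D. x < d \<longrightarrow> x \<le> s" unfolding s_def by (rule LeastI[of _ d]) auto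
  have "s \<le> d" unfolding s_def by (rule Least_le) auto
  have least: "\<exists>x\<in>D. x < d \<and> \<epsilon> < x" if "\<epsilon> < s" for \<epsilon>
    using not_less_Least[OF that[unfolded s_def]] by (auto simp: not_le)
  obtain y where y: "y \<in> D" "y < d" using assms(3) by auto
  have "s \<noteq> d"
  proof
    assume "s = d"
    moreover have "ozero < d" using ozero_le y(2) by (rule order_le_less_trans)
    ultimately have "limit_point D d" using least unfolding limit_point_def by blast
    with assms(4) show False ..
  qed
  with \<open>s \<le> d\<close> have "s < d" by simp
  have "s \<in> D"
  proof (rule ccontr)
    assume s: "s \<notin> D"
    then have lt: "x < s" if "x \<in> D" "x < d" for x using ub that by (metis order_le_less)
    have "ozero < s" using ozero_le lt[OF y] by (rule order_le_less_trans)
    moreover have "\<exists>x\<in>D. \<epsilon> < x \<and> x < s" if "\<epsilon> < s" for \<epsilon> using least[OF that] lt by blast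
    ultimately have "limit_point D s" by (simp add: limit_point_def)
    with closed s \<open>s < d\<close> \<open>d \<le> \<alpha>\<close> show False by auto
  qed
  with that \<open>s < d\<close> ub show ?thesis by blast
qed

lemma unbounded_closed_limit: "unbounded_closed C \<alpha> \<Longrightarrow> limit_point C \<alpha>"
  unfolding unbounded_closed_def limit_point_def
  by (metis all_not_in_conv lessThan_iff order_le_less_trans ozero_le subset_eq)

section \<open>Comparing order types through accumulation points\<close>

text \<open>If \<open>D\<close> were longer, matching elements of equal rank would carry
  \<open>C\<close> onto a proper initial segment of \<open>D\<close>, so that infinitely many points
  of \<open>C\<close> lie above the image of \<alpha>. Descending through points with such an
  infinite loss gives the contradiction.\<close>

lemma otp_le_of_acc_subset:
  assumes C: "unbounded_closed C \<alpha>" and D: "unbounded_closed D \<alpha>" and "acc D \<subseteq> acc C"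
  shows "otp D \<le> otp C"
proof (rule ccontr)
  assume "\<not> otp D \<le> otp C"
  then have lt: "otp C < otp D" by simp
  have C\<alpha>: "C \<subseteq> {..<\<alpha>}" and D\<alpha>: "D \<subseteq> {..<\<alpha>}" using C D by (auto simp: unbounded_closed_def)
  have clC: "\<forall>\<delta><\<alpha>. limit_point C \<delta> \<longrightarrow> \<delta> \<in> C" and clD: "\<forall>\<delta><\<alpha>. limit_point D \<delta> \<longrightarrow> \<delta> \<in> D"
    using C D by (auto simp: unbounded_closed_def)
  obtain f where f: "enumerates f (otp D) D" using enumerates_otp[OF D\<alpha>] .
  \<comment> \<open>Adjoining \<alpha> as a top point of rank \<open>otp C < otp D\<close> gives it
    an image in \<open>D\<close>, hence below \<alpha>.\<close>
  define C' where "C' = insert \<alpha> C"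
  define r where "r c = otp (C \<inter> {..<c})" for c
  define h where "h c = f (r c)" for c
  have "C \<inter> {..<\<alpha>} = C" using C\<alpha> by blast
  then have r\<alpha>: "r \<alpha> = otp C" by (simp add: r_def)
  have rD: "r c < otp D" if "c \<in> C'" for c
    using that lt r\<alpha> otp_Int_less[OF C\<alpha>, of c] unfolding C'_def r_def by auto
  have r_mono: "r c < r c'" if "c \<in> C" "c < c'" for c c'
  proof -
    have "C \<inter> {..<c'} \<inter> {..<c} = C \<inter> {..<c}" using that by auto
    then show ?thesis unfolding r_def using otp_Int_less[of "C \<inter> {..<c'}" c' c] that by simp
  qed
  have h_mono: "h c < h c'" if "c \<in> C" "c' \<in> C'" "c < c'" for c c'
    using f r_mono[OF that(1,3)] rD[of c] rD[OF that(2)] that(1)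
    by (simp add: h_def enumerates_def strict_mono_on_def C'_def)
  have hD: "h c \<in> D" if "c \<in> C'" for c
    using f rD[OF that] by (auto simp: h_def enumerates_def bij_betw_def)
  have below: "\<exists>c'\<in>C. c' < c \<and> x = h c'" if "c \<in> C'" "x \<in> D" "x < h c" for c x
  proof -
    have "x \<in> f ` {..<r c}"
      using enumerates_restrict[OF f rD[OF that(1)]] that
      by (auto simp: enumerates_def bij_betw_def h_def)
    then obtain j where j: "j < r c" "x = f j" by auto
    have "C \<inter> {..<c} \<subseteq> {..<c}" by blast
    from elem_at_mem[OF this j(1)[unfolded r_def]]
    obtain c' where c': "c' \<in> C" "c' < c" "otp (C \<inter> {..<c} \<inter> {..<c'}) = j" by blast
    moreover have "C \<inter> {..<c} \<inter> {..<c'} = C \<inter> {..<c'}" using c' by auto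
    ultimately show ?thesis using j by (auto simp: h_def r_def)
  qed
  \<comment> \<open>\<open>h\<close> maps \<open>C\<close> isomorphically onto an initial segment of \<open>D\<close>. A minimal bad \<open>c\<close> is a limit point of \<open>C\<close>,
    so \<open>h c\<close> lies in \<open>acc D \<subseteq> acc C\<close> and is itself bad.\<close>
  define bad where "bad c \<longleftrightarrow> c \<in> C' \<and> infinite (C \<inter> {h c..<c})" for c
  have "h \<alpha> < \<alpha>" using hD[of \<alpha>] D\<alpha> by (auto simp: C'_def)
  then have "bad \<alpha>"
    using limit_point_infinite[OF unbounded_closed_limit[OF C]] by (simp add: bad_def C'_def)
  define c where "c = (LEAST c. bad c)"
  have "bad c" unfolding c_def using \<open>bad \<alpha>\<close> by (rule LeastI)
  have minimal: "\<not> bad c'" if "c' < c" for c'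
    using that unfolding c_def by (rule not_less_Least)
  have "c \<in> C'" and inf: "infinite (C \<inter> {h c..<c})" using \<open>bad c\<close> by (auto simp: bad_def)
  then have "c \<le> \<alpha>" using C\<alpha> by (auto simp: C'_def)
  have "C \<inter> {h c..<c} \<noteq> {}" using inf by (metis finite.emptyI)
  then obtain e where e: "e \<in> C" "h c \<le> e" "e < c" by auto
  have climit: "limit_point C c"
  proof (rule ccontr)
    assume "\<not> limit_point C c"
    moreover have "C \<inter> {..<c} \<noteq> {}" using e by auto
    ultimately obtain m where m: "m \<in> C" "m < c" "\<forall>x\<in>C. x < c \<longrightarrow> x \<le> m"
      using closed_has_max[OF clC \<open>c \<le> \<alpha>\<close>] by blast
    have "h m < h c" using h_mono[OF m(1) \<open>c \<in> C'\<close> m(2)] .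
    \<comment> \<open>Passing from \<open>c\<close> to its predecessor \<open>m\<close> in
      \<open>C\<close> discards only the point \<open>m\<close>, so the loss at \<open>m\<close> is
      still infinite.\<close>
    then have "C \<inter> {h c..<c} \<subseteq> insert m (C \<inter> {h m..<m})" using m by force
    then have "infinite (C \<inter> {h m..<m})" using inf by (meson finite.insertI finite_subset)
    then have "bad m" using m(1) by (simp add: bad_def C'_def)
    with minimal[OF m(2)] show False ..
  qed
  define d where "d = h c"
  have d: "d \<in> D" "d < \<alpha>" using hD[OF \<open>c \<in> C'\<close>] D\<alpha> by (auto simp: d_def)
  have "limit_point D d"
  proof (rule ccontr)
    assume *: "\<not> limit_point D d"
    have "h e \<in> D \<inter> {..<d}" using h_mono[OF e(1) \<open>c \<in> C'\<close> e(3)] hD[of e] e by (simp add: d_def C'_def)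
    then have "D \<inter> {..<d} \<noteq> {}" by blast
    then obtain m where m: "m \<in> D" "m < d" "\<forall>x\<in>D. x < d \<longrightarrow> x \<le> m"
      using closed_has_max[OF clD less_imp_le[OF d(2)] _ *] by blast
    \<comment> \<open>The predecessor \<open>m\<close> of \<open>d\<close> in \<open>D\<close> is
      matched with some \<open>c1 < c\<close>. As \<open>c\<close> is a limit point of
      \<open>C\<close>, some \<open>c2\<close> lies between, and \<open>h c2\<close> would lie
      between \<open>m\<close> and \<open>d\<close>.\<close>
    then obtain c1 where c1: "c1 \<in> C" "c1 < c" "m = h c1"
      using below[OF \<open>c \<in> C'\<close>] by (auto simp: d_def)
    then obtain c2 where c2: "c2 \<in> C" "c1 < c2" "c2 < c"
      using climit by (auto simp: limit_point_def)
    have "h c1 < h c2" "h c2 < d" "h c2 \<in> D"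
      using h_mono[OF c1(1) _ c2(2)] h_mono[OF c2(1) \<open>c \<in> C'\<close> c2(3)] hD[of c2] c2
      by (auto simp: d_def C'_def)
    with m c1 show False by auto
  qed
  with d have "d \<in> acc D" by (simp add: acc_eq)
  with assms(3) have "d \<in> C" "limit_point C d" by (auto simp: acc_eq)
  have "d < c" using e by (auto simp: d_def)
  have "h d < d" using h_mono[OF \<open>d \<in> C\<close> \<open>c \<in> C'\<close> \<open>d < c\<close>] by (simp add: d_def)
  then have "bad d"
    using limit_point_infinite[OF \<open>limit_point C d\<close>] \<open>d \<in> C\<close> by (simp add: bad_def C'_def)
  with minimal \<open>d < c\<close> show False by blast
qed

section \<open>Guessing finite sets\<close>

text \<open>Regularity gives \<open>\<kappa> = cf \<kappa> \<le> otp A\<close>, so a countable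
  \<open>A\<close> would make \<kappa> countable.\<close>

lemma cofinal_uncountable:
  assumes "regular_uncountable \<kappa>" "cofinal_in A \<kappa>"
  shows "uncountable A"
proof
  assume "countable A"
  have "A \<subseteq> {..<\<kappa>}" using assms(2) by (simp add: cofinal_in_def)
  then have "countable {..<otp A}" using otp_eqpoll \<open>countable A\<close> countable_eqpoll by blast
  moreover have "cf \<kappa> \<le> otp A" unfolding cf_def by (rule Least_le) (use assms(2) in blast)
  then have "{..<\<kappa>} \<subseteq> {..<otp A}" using assms(1) by (auto simp: regular_uncountable_def)
  ultimately have "countable {..<\<kappa>}" by (rule countable_subset[rotated])
  with assms(1) show False by (simp add: regular_uncountable_def)
qed

lemma regular_no_max:
  assumes "regular_uncountable \<kappa>" "\<epsilon> < \<kappa>"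
  obtains x where "\<epsilon> < x" "x < \<kappa>"
proof -
  have "\<not> cofinal_in {\<epsilon>} \<kappa>" using cofinal_uncountable[OF assms(1)] by force
  with assms(2) that show ?thesis by (auto simp: cofinal_in_def not_le)
qed

text \<open>Without limits above \<gamma>, induction makes every interval from \<gamma> to
  \<open>x\<close> finite. Its cardinality then determines \<open>x\<close>, so the tail above
  \<gamma> would be countable although it is cofinal.\<close>

lemma limits_unbounded:
  assumes \<kappa>: "regular_uncountable \<kappa>" and "\<gamma> < \<kappa>"
  shows "\<exists>\<delta>\<in>acc {..<\<kappa>}. \<gamma> < \<delta>"
proof (rule ccontr)
  assume "\<not> ?thesis"
  then have none: "\<delta> \<notin> acc {..<\<kappa>}" if "\<gamma> < \<delta>" for \<delta> using that by blast
  have fin: "finite {\<gamma><..<x}" if "x < \<kappa>" for x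
    using that
  proof (induction x rule: less_induct)
    case (less x)
    show ?case
    proof (cases "\<gamma> < x")
      case True
      then have "x \<noteq> ozero" using ozero_le[of \<gamma>] by auto
      with less.prems none[OF True] obtain y where y: "y < x" "x = osucc y"
        by (cases rule: limit_cases[OF less.prems]) auto
      then have "{\<gamma><..<x} \<subseteq> insert y {\<gamma><..<y}"
        using osucc_le[of y] by (auto dest: leD) (meson leD linorder_neqE)
      moreover have "finite {\<gamma><..<y}" using less y by simp
      ultimately show ?thesis by (meson finite.insertI finite_subset)
    qed simp
  qed
  have "inj_on (\<lambda>x. card {\<gamma><..<x}) {\<gamma><..<\<kappa>}"
  proof (rule linorder_inj_onI)
    fix x y assume xy: "x < y" "x \<in> {\<gamma><..<\<kappa>}" "y \<in> {\<gamma><..<\<kappa>}"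
    then have "{\<gamma><..<x} \<subset> {\<gamma><..<y}" by auto
    with fin[of y] xy show "card {\<gamma><..<x} \<noteq> card {\<gamma><..<y}"
      using psubset_card_mono by (metis greaterThanLessThan_iff order_less_irrefl)
  qed auto
  then have "countable {\<gamma><..<\<kappa>}" by (rule countableI)
  moreover have "cofinal_in {\<gamma><..<\<kappa>} \<kappa>"
    unfolding cofinal_in_def
  proof (intro conjI allI impI)
    fix \<epsilon> assume "\<epsilon> < \<kappa>"
    then have "max \<epsilon> \<gamma> < \<kappa>" using assms(2) by simp
    then obtain x where "max \<epsilon> \<gamma> < x" "x < \<kappa>" using regular_no_max[OF \<kappa>] by blast
    then show "\<exists>a\<in>{\<gamma><..<\<kappa>}. \<epsilon> \<le> a" by (intro bexI[of _ x]) auto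
  qed auto
  ultimately show False using cofinal_uncountable[OF \<kappa>] by blast
qed

text \<open>The limit ordinals above a given \<gamma> form a club, which \<open>S\<close> must
  meet.\<close>

lemma stationary_limits_cofinal:
  assumes \<kappa>: "regular_uncountable \<kappa>" and S: "stationary_in S \<kappa>"
  shows "cofinal_in (S \<inter> acc {..<\<kappa>}) \<kappa>"
  unfolding cofinal_in_def
proof (intro conjI allI impI)
  show "S \<inter> acc {..<\<kappa>} \<subseteq> {..<\<kappa>}" by (auto simp: acc_eq)
  fix \<gamma> assume "\<gamma> < \<kappa>"
  define E where "E = {\<delta> \<in> acc {..<\<kappa>}. \<gamma> < \<delta>}"
  have "cofinal_in E \<kappa>"
    unfolding cofinal_in_def
  proof (intro conjI allI impI)
    fix \<epsilon> assume "\<epsilon> < \<kappa>"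
    then have "max \<epsilon> \<gamma> < \<kappa>" using \<open>\<gamma> < \<kappa>\<close> by simp
    then obtain x where "max \<epsilon> \<gamma> < x" "x \<in> acc {..<\<kappa>}" using limits_unbounded[OF \<kappa>] by blast
    then show "\<exists>a\<in>E. \<epsilon> \<le> a" by (intro bexI[of _ x]) (auto simp: E_def)
  qed (auto simp: E_def acc_eq)
  moreover have "\<alpha> \<in> E" if \<alpha>: "\<alpha> < \<kappa>" "limit_point E \<alpha>" for \<alpha>
  proof -
    have "limit_point {..<\<kappa>} \<alpha>" using \<alpha> unfolding limit_point_def by (meson lessThan_iff order_less_trans)
    moreover obtain x where "x \<in> E" "x < \<alpha>" using \<alpha> unfolding limit_point_def by blast
    ultimately show ?thesis using \<alpha>(1) by (auto simp: E_def acc_eq)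
  qed
  ultimately have "club_in E \<kappa>" by (simp add: club_in_iff)
  with S obtain x where "x \<in> S" "x \<in> E" by (auto simp: stationary_in_def)
  then show "\<exists>a\<in>S \<inter> acc {..<\<kappa>}. \<gamma> \<le> a" by (intro bexI[of _ x]) (auto simp: E_def)
qed

section \<open>Coding finite sets by ordinals\<close>

text \<open>A reserved point \<open>a\<close> codes the empty list and an injective pairing
  \<open>p\<close> avoids \<open>a\<close>; folding \<open>p\<close> over a list can then be
  undone.\<close>

lemma inj_lists_infinite:
  assumes "infinite A"
  obtains e where "inj_on e (lists A)" "e ` lists A \<subseteq> A"
proof -
  obtain a where a: "a \<in> A" using assms by (metis ex_in_conv finite.emptyI)
  have "A \<times> A \<lesssim> A"
    using card_of_Times_same_infinite[OF assms] by (simp add: eqpoll_imp_lepoll eqpoll_iff_card_of_ordIso)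
  also have "A \<lesssim> A - {a}"
    using infinite_insert_lepoll[of "A - {a}" a] assms a by (simp add: insert_absorb)
  finally obtain p where p: "inj_on p (A \<times> A)" "p ` (A \<times> A) \<subseteq> A - {a}" by (auto simp: lepoll_def)
  define e where "e xs = foldr (\<lambda>x r. p (x, r)) xs a" for xs
  have e_simps: "e [] = a" "e (x # xs) = p (x, e xs)" for x xs by (simp_all add: e_def)
  have pA: "p (x, y) \<in> A" "p (x, y) \<noteq> a" if "x \<in> A" "y \<in> A" for x y
    using p(2) imageI[of "(x, y)" "A \<times> A" p] that by auto
  have eA: "set xs \<subseteq> A \<Longrightarrow> e xs \<in> A" for xs
    by (induction xs) (simp_all add: e_simps a pA)
  have "xs = ys" if "set xs \<subseteq> A" "set ys \<subseteq> A" "e xs = e ys" for xs ys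
    using that
  proof (induction xs arbitrary: ys)
    case Nil
    show ?case
    proof (cases ys)
      case (Cons y zs)
      with Nil pA(2)[of y "e zs"] eA[of zs] show ?thesis by (simp add: e_simps)
    qed simp
  next
    case (Cons x xs)
    show ?case
    proof (cases ys)
      case Nil
      with Cons.prems pA(2)[of x "e xs"] eA[of xs] show ?thesis by (simp add: e_simps)
    next
      case ys: (Cons y zs)
      then have "p (x, e xs) = p (y, e zs)" using Cons.prems by (simp add: e_simps)
      moreover have "(x, e xs) \<in> A \<times> A" "(y, e zs) \<in> A \<times> A" using Cons.prems ys eA by auto
      ultimately have "x = y" "e xs = e zs" using inj_onD[OF p(1)] by blast+
      with Cons.IH[of zs] Cons.prems ys show ?thesis by simp
    qed
  qed
  then have "inj_on e (lists A)" by (auto intro!: inj_onI simp: lists_eq_set)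
  moreover have "e ` lists A \<subseteq> A" using eA by (auto simp: lists_eq_set)
  ultimately show ?thesis by (rule that)
qed

text \<open>Large codes are needed in order to place a code above the set that it codes. They exist
  because \<kappa> many distinct codes do not fit below an ordinal smaller than the cardinal
  \<kappa>.\<close>

lemma finite_set_coding:
  assumes \<kappa>: "regular_uncountable \<kappa>"
  obtains dec :: "'o::wellorder \<Rightarrow> 'o set" where "\<And>x. finite (dec x)"
    "\<And>F \<delta>. \<lbrakk>finite F; F \<subseteq> {..<\<kappa>}; \<delta> < \<kappa>\<rbrakk> \<Longrightarrow> \<exists>x<\<kappa>. \<delta> < x \<and> dec x = F"
proof -
  have "infinite {..<\<kappa>}" using \<kappa> countable_finite by (auto simp: regular_uncountable_def)
  then obtain e where e: "inj_on e (lists {..<\<kappa>})" "e ` lists {..<\<kappa>} \<subseteq> {..<\<kappa>}"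
    using inj_lists_infinite by blast
  \<comment> \<open>The ignored head of the list gives each finite set \<open>\<kappa>\<close> many codes, hence arbitrarily large ones.\<close>
  define dec where "dec x = set (tl (inv_into (lists {..<\<kappa>}) e x))" for x
  have dec: "dec (e (y # xs)) = set xs" if "y < \<kappa>" "set xs \<subseteq> {..<\<kappa>}" for y xs
  proof -
    have "y # xs \<in> lists {..<\<kappa>}" using that by auto
    then show ?thesis unfolding dec_def by (simp add: inv_into_f_f[OF e(1)])
  qed
  show ?thesis
  proof
    show "finite (dec x)" for x by (simp add: dec_def)
    fix F \<delta> assume F: "finite F" "F \<subseteq> {..<\<kappa>}" and \<delta>: "\<delta> < \<kappa>"
    obtain xs where xs: "F = set xs" using finite_list[OF F(1)] by blast
    define c where "c y = e (y # xs)" for y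
    have cl: "y # xs \<in> lists {..<\<kappa>}" if "y < \<kappa>" for y using that F(2) xs by auto
    have inj: "inj_on c {..<\<kappa>}"
      by (rule inj_onI) (metis c_def cl e(1) inj_onD lessThan_iff list.inject)
    obtain \<delta>' where \<delta>': "\<delta> < \<delta>'" "\<delta>' < \<kappa>" using regular_no_max[OF \<kappa> \<delta>] .
    have "\<exists>y<\<kappa>. \<delta> < c y"
    proof (rule ccontr)
      assume "\<not> (\<exists>y<\<kappa>. \<delta> < c y)"
      then have "c ` {..<\<kappa>} \<subseteq> {..<\<delta>'}" using \<delta>' by fastforce
      then have "{..<\<kappa>} \<lesssim> {..<\<delta>'}" using inj by (auto simp: lepoll_def)
      moreover have "{..<\<delta>'} \<prec> {..<\<kappa>}" using \<kappa> \<delta>' by (auto simp: regular_uncountable_def is_cardinal_def)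
      ultimately show False using lesspoll_trans1 lesspoll_not_refl by blast
    qed
    then obtain y where y: "y < \<kappa>" "\<delta> < c y" by blast
    have "c y < \<kappa>" using e(2) imageI[OF cl[OF y(1)], of e] unfolding c_def by blast
    moreover have "dec (c y) = F" using dec[OF y(1)] F(2) xs by (simp add: c_def)
    ultimately show "\<exists>x<\<kappa>. \<delta> < x \<and> dec x = F" using y by blast
  qed
qed

section \<open>Decoding the sequence given by \<open>clubsuit_principle\<close>\<close>

text \<open>The function \<open>G\<close> depends only on the guessing sequence \<open>X\<close>.
  For a given \<open>\<F>\<close>, guessing is applied to a cofinal set \<open>Y\<close> of codes of
  members of \<open>\<F>\<close>; where \<open>X \<beta> \<subseteq> Y\<close>, every set decoded
  from \<open>X \<beta>\<close> is in \<open>\<F>\<close>.\<close>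

lemma finite_set_guessing:
  fixes \<kappa> :: "'o::wellorder"
  assumes \<kappa>: "regular_uncountable \<kappa>" and club: "clubsuit_principle \<kappa>"
  obtains G :: "'o \<Rightarrow> 'o \<Rightarrow> 'o set" where
    "\<And>\<beta> \<gamma>. finite (G \<beta> \<gamma>)" "\<And>\<beta> \<gamma>. G \<beta> \<gamma> \<subseteq> {\<gamma><..<\<beta>}"
    "\<And>\<beta> \<gamma>. G \<beta> \<gamma> \<noteq> {} \<Longrightarrow> \<beta> \<in> acc {..<\<kappa>}"
    "\<And>\<F>. (\<forall>\<delta><\<kappa>. \<exists>F\<in>\<F>. finite F \<and> F \<subseteq> {\<delta><..<\<kappa>}) \<Longrightarrow>
       cofinal_in {\<beta> \<in> acc {..<\<kappa>}. \<forall>\<gamma><\<beta>. G \<beta> \<gamma> \<in> \<F>} \<kappa>"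
proof -
  obtain dec :: "'o \<Rightarrow> 'o set" where fin: "\<And>x. finite (dec x)" and
    dec: "\<And>F \<delta>. \<lbrakk>finite F; F \<subseteq> {..<\<kappa>}; \<delta> < \<kappa>\<rbrakk> \<Longrightarrow> \<exists>x<\<kappa>. \<delta> < x \<and> dec x = F"
    using finite_set_coding[OF \<kappa>] by metis
  obtain X where X: "\<And>\<delta>. \<delta> \<in> acc {..<\<kappa>} \<Longrightarrow> cofinal_in (X \<delta>) \<delta>"
    and guess: "\<And>Y. cofinal_in Y \<kappa> \<Longrightarrow> stationary_in {\<delta>. \<delta> < \<kappa> \<and> X \<delta> \<subseteq> Y} \<kappa>"
    using club by (auto simp: clubsuit_principle_def)
  define fits where "fits \<beta> \<gamma> x \<longleftrightarrow> x \<in> X \<beta> \<and> dec x \<subseteq> {\<gamma><..<\<beta>}" for \<beta> \<gamma> x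
  \<comment> \<open>The empty default makes the first three properties hold for all arguments, in
    particular at non-limit \<beta>.\<close>
  define G where "G \<beta> \<gamma> = (if \<beta> \<in> acc {..<\<kappa>} \<and> (\<exists>x. fits \<beta> \<gamma> x) then dec (LEAST x. fits \<beta> \<gamma> x) else {})"
    for \<beta> \<gamma>
  have least: "fits \<beta> \<gamma> (LEAST x. fits \<beta> \<gamma> x)" if "fits \<beta> \<gamma> x" for \<beta> \<gamma> x
    using that by (rule LeastI)
  show ?thesis
  proof
    show "finite (G \<beta> \<gamma>)" for \<beta> \<gamma> by (simp add: G_def fin)
    show "G \<beta> \<gamma> \<subseteq> {\<gamma><..<\<beta>}" for \<beta> \<gamma> using least by (auto simp: G_def fits_def)
    show "\<beta> \<in> acc {..<\<kappa>}" if "G \<beta> \<gamma> \<noteq> {}" for \<beta> \<gamma> using that by (auto simp: G_def split: if_splits)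
    fix \<F> assume \<F>: "\<forall>\<delta><\<kappa>. \<exists>F\<in>\<F>. finite F \<and> F \<subseteq> {\<delta><..<\<kappa>}"
    \<comment> \<open>A greedily thinned set of codes: each one codes a set lying strictly between all earlier
      chosen codes and itself. So wherever \<open>X \<beta>\<close> is contained in it, \<open>X \<beta>\<close> yields codes of sets in
      every final segment of \<open>\<beta>\<close>.\<close>
    define step where "step Y x \<longleftrightarrow> x < \<kappa> \<and> dec x \<in> \<F> \<and> dec x \<subseteq> {..<x} \<and>
      (\<forall>y<x. Y y \<longrightarrow> dec x \<subseteq> {y<..})" for Y x
    define inY where "inY = wfrec {(x, y :: 'o). x < y} step"
    have inY: "inY x \<longleftrightarrow> step inY x" for x
    proof -
      \<comment> \<open>The cut is harmless because \<open>step\<close> consults only arguments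
        below \<open>x\<close>.\<close>
      have "inY x = step (cut inY {(x, y). x < y} x) x" unfolding inY_def by (rule wfrec[OF wf])
      also have "\<dots> = step inY x" by (simp add: step_def cut_apply)
      finally show ?thesis .
    qed
    define Y where "Y = {x. inY x}"
    have Y: "cofinal_in Y \<kappa>"
      unfolding cofinal_in_def
    proof (intro conjI allI impI)
      show "Y \<subseteq> {..<\<kappa>}" by (auto simp: Y_def step_def dest!: iffD1[OF inY])
      fix \<gamma> assume \<gamma>: "\<gamma> < \<kappa>"
      show "\<exists>a\<in>Y. \<gamma> \<le> a"
      proof (rule ccontr)
        assume "\<not> (\<exists>a\<in>Y. \<gamma> \<le> a)"
        then have low: "y < \<gamma>" if "inY y" for y using that by (auto simp: Y_def not_le)
        obtain F where F: "F \<in> \<F>" "finite F" "F \<subseteq> {\<gamma><..<\<kappa>}" using \<F> \<gamma> by blast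
        \<comment> \<open>If \<open>Y\<close> stayed below \<gamma>, a code of \<open>F\<close>
          chosen beyond both \<gamma> and \<open>F\<close> would satisfy \<open>step\<close> and so
          belong to \<open>Y\<close>.\<close>
        define \<delta> where "\<delta> = Max (insert \<gamma> F)"
        have \<delta>: "\<delta> < \<kappa>" "\<gamma> \<le> \<delta>" "\<forall>x\<in>F. x \<le> \<delta>" using F \<gamma> by (auto simp: \<delta>_def)
        have "F \<subseteq> {..<\<kappa>}" using F by auto
        then obtain x where x: "x < \<kappa>" "\<delta> < x" "dec x = F" using dec[OF F(2) _ \<delta>(1)] by blast
        have "F \<subseteq> {y<..}" if "inY y" for y using low[OF that] F(3) by fastforce
        moreover have "F \<subseteq> {..<x}" using \<delta>(3) x(2) by fastforce
        ultimately have "step inY x" unfolding step_def using x F(1) by blast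
        then have "inY x" by (rule iffD2[OF inY])
        with low[of x] x(2) \<delta>(2) show False by auto
      qed
    qed
    have sub: "{\<delta>. \<delta> < \<kappa> \<and> X \<delta> \<subseteq> Y} \<inter> acc {..<\<kappa>} \<subseteq> {\<beta> \<in> acc {..<\<kappa>}. \<forall>\<gamma><\<beta>. G \<beta> \<gamma> \<in> \<F>}"
    proof clarify
      fix \<beta> \<gamma> assume \<beta>: "\<beta> \<in> acc {..<\<kappa>}" "X \<beta> \<subseteq> Y" and "\<gamma> < \<beta>"
      have lim: "\<exists>y. \<epsilon> < y \<and> y < \<beta>" if "\<epsilon> < \<beta>" for \<epsilon>
        using \<beta>(1) that by (auto simp: acc_eq limit_point_def)
      have XX: "X \<beta> \<subseteq> {..<\<beta>}" "\<And>\<epsilon>. \<epsilon> < \<beta> \<Longrightarrow> \<exists>a\<in>X \<beta>. \<epsilon> \<le> a"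
        using X[OF \<beta>(1)] by (auto simp: cofinal_in_def)
      \<comment> \<open>Two elements \<open>y < x\<close> of \<open>X \<beta>\<close> with
        \<open>\<gamma> \<le> y\<close> are needed: the thinning puts \<open>dec x\<close> strictly
        between them, hence between \<gamma> and \<beta>.\<close>
      obtain y where y: "y \<in> X \<beta>" "\<gamma> \<le> y" using XX(2)[OF \<open>\<gamma> < \<beta>\<close>] by blast
      then have "y < \<beta>" using XX(1) by auto
      then obtain y' where "y < y'" "y' < \<beta>" using lim by blast
      then obtain x where x: "x \<in> X \<beta>" "y < x" using XX(2)[of y'] by force
      have "step inY x" "inY y" using x y \<beta>(2) iffD1[OF inY] unfolding Y_def by blast+
      then have "dec x \<subseteq> {y<..}" "dec x \<subseteq> {..<x}" using x(2) by (auto simp: step_def)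
      then have "fits \<beta> \<gamma> x" unfolding fits_def using x y XX(1) by fastforce
      then have eq: "G \<beta> \<gamma> = dec (LEAST x. fits \<beta> \<gamma> x)" and "fits \<beta> \<gamma> (LEAST x. fits \<beta> \<gamma> x)"
        using least \<beta>(1) by (auto simp: G_def)
      then have "inY (LEAST x. fits \<beta> \<gamma> x)" using \<beta>(2) by (auto simp: fits_def Y_def)
      then show "G \<beta> \<gamma> \<in> \<F>" unfolding eq by (auto simp: step_def dest!: iffD1[OF inY])
    qed
    have "cofinal_in ({\<delta>. \<delta> < \<kappa> \<and> X \<delta> \<subseteq> Y} \<inter> acc {..<\<kappa>}) \<kappa>"
      by (rule stationary_limits_cofinal[OF \<kappa> guess[OF Y]])
    with sub show "cofinal_in {\<beta> \<in> acc {..<\<kappa>}. \<forall>\<gamma><\<beta>. G \<beta> \<gamma> \<in> \<F>} \<kappa>"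
      unfolding cofinal_in_def acc_eq by blast
  qed
qed

section \<open>Gaps and blocks\<close>

lemma unbounded_closed_exists:
  assumes "unbounded_closed C \<alpha>" "\<epsilon> < \<alpha>" obtains a where "a \<in> C" "\<epsilon> < a"
  using assms unfolding unbounded_closed_def by blast

definition gap :: "'o::wellorder set \<Rightarrow> 'o \<Rightarrow> 'o \<Rightarrow> bool" where
  "gap C \<gamma> \<beta> \<longleftrightarrow> \<gamma> \<in> C \<and> \<beta> \<in> C \<and> \<gamma> < \<beta> \<and> C \<inter> {\<gamma><..<\<beta>} = {}"

lemma gap_exists:
  assumes "\<gamma> \<in> C" "a \<in> C" "\<gamma> < a"
  obtains \<beta> where "gap C \<gamma> \<beta>"
proof -
  define \<beta> where "\<beta> = (LEAST b. b \<in> C \<and> \<gamma> < b)"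
  have "\<beta> \<in> C \<and> \<gamma> < \<beta>" unfolding \<beta>_def by (rule LeastI[of _ a]) (use assms in simp)
  moreover have "C \<inter> {\<gamma><..<\<beta>} = {}" using not_less_Least unfolding \<beta>_def by fastforce
  ultimately have "gap C \<gamma> \<beta>" using assms(1) by (simp add: gap_def)
  then show ?thesis by (rule that)
qed

lemma gap_left: "\<lbrakk>gap C \<gamma> \<beta>; c \<in> C; c < \<beta>\<rbrakk> \<Longrightarrow> c \<le> \<gamma>"
  unfolding gap_def by (metis IntI empty_iff greaterThanLessThan_iff not_le)

lemma gap_right: "\<lbrakk>gap C \<gamma> \<beta>; c \<in> C; \<gamma> < c\<rbrakk> \<Longrightarrow> \<beta> \<le> c"
  unfolding gap_def by (metis IntI empty_iff greaterThanLessThan_iff not_le)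

text \<open>
  A block has \<open>n + 1\<close> elements because \<open>succ_set\<close>, started at the least of them, skips that one.
\<close>

definition has_block :: "nat \<Rightarrow> 'o::wellorder set \<Rightarrow> 'o set \<Rightarrow> bool" where
  "has_block n F B \<longleftrightarrow>
     (\<exists>H. H \<subseteq> F \<inter> B \<and> finite H \<and> card H = Suc n \<and> (\<forall>x\<in>F. Min H \<le> x \<and> x \<le> Max H \<longrightarrow> x \<in> H))"

text \<open>New points above all of \<open>F\<close> lie beyond \<open>Max H\<close> and cannot
  interrupt the block.\<close>

lemma has_block_Un:
  assumes "has_block n F B" "\<forall>x\<in>F. \<forall>y\<in>K. x < y"
  shows "has_block n (F \<union> K) B"
proof -
  obtain H where H: "H \<subseteq> F \<inter> B" "finite H" "card H = Suc n"
    "\<forall>x\<in>F. Min H \<le> x \<and> x \<le> Max H \<longrightarrow> x \<in> H"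
    using assms(1) by (auto simp: has_block_def)
  have "H \<noteq> {}" using H by auto
  then have "Max H \<in> F" using H Max_in by blast
  then have "\<not> y \<le> Max H" if "y \<in> K" for y using assms(2) that by (meson leD)
  with H show ?thesis unfolding has_block_def by (intro exI[of _ H]) auto
qed

text \<open>All older points lie below \<open>Min H\<close>, so \<open>H\<close> itself is the
  block.\<close>

lemma has_block_Un_self:
  assumes "finite H" "card H = Suc n" "H \<subseteq> B" "\<forall>x\<in>F. \<forall>y\<in>H. x < y"
  shows "has_block n (F \<union> H) B"
proof -
  have "H \<noteq> {}" using assms by auto
  then have "Min H \<in> H" using assms by simp
  then have "\<not> Min H \<le> x" if "x \<in> F" for x using assms(4) that by (meson leD)
  then show ?thesis unfolding has_block_def using assms by (intro exI[of _ H]) auto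
qed

text \<open>The blocks are stacked, each drawn from \<open>B i\<close> above everything chosen so
  far. A tail of a cofinal set is again cofinal, hence infinite, so it has enough points.\<close>

lemma blocks_exist:
  assumes \<kappa>: "regular_uncountable \<kappa>" and "finite I" "\<forall>i\<in>I. cofinal_in (B i) \<kappa>" "\<delta> < \<kappa>"
  shows "\<exists>F. finite F \<and> F \<subseteq> {\<delta><..<\<kappa>} \<and> (\<forall>i\<in>I. has_block n F (B i))"
  using assms(2,3)
proof (induction I)
  case empty
  then show ?case by (intro exI[of _ "{}"]) simp
next
  case (insert i I)
  then obtain F where F: "finite F" "F \<subseteq> {\<delta><..<\<kappa>}" "\<forall>i\<in>I. has_block n F (B i)" by auto
  define m where "m = Max (insert \<delta> F)"
  have m: "m < \<kappa>" "\<delta> \<le> m" "\<forall>x\<in>F. x \<le> m" using F(1,2) \<open>\<delta> < \<kappa>\<close> by (auto simp: m_def)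
  have "cofinal_in (B i \<inter> {m<..}) \<kappa>"
    unfolding cofinal_in_def
  proof (intro conjI allI impI)
    show "B i \<inter> {m<..} \<subseteq> {..<\<kappa>}" using insert.prems by (auto simp: cofinal_in_def)
    fix \<gamma> assume "\<gamma> < \<kappa>"
    then have "max \<gamma> m < \<kappa>" using m by simp
    then obtain y where y: "max \<gamma> m < y" "y < \<kappa>" using regular_no_max[OF \<kappa>] by blast
    then obtain a where "a \<in> B i" "y \<le> a" using insert.prems by (auto simp: cofinal_in_def)
    with y show "\<exists>a\<in>B i \<inter> {m<..}. \<gamma> \<le> a" by (intro bexI[of _ a]) auto
  qed
  then have "infinite (B i \<inter> {m<..})" using cofinal_uncountable[OF \<kappa>] countable_finite by blast
  then obtain H where H: "H \<subseteq> B i \<inter> {m<..}" "finite H" "card H = Suc n"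
    using infinite_arbitrarily_large by metis
  have FH: "\<forall>x\<in>F. \<forall>y\<in>H. x < y" using m(3) H(1) by fastforce
  have "B i \<subseteq> {..<\<kappa>}" using insert.prems by (simp add: cofinal_in_def)
  then have "F \<union> H \<subseteq> {\<delta><..<\<kappa>}" using F(2) H(1) m(2) by fastforce
  moreover have "has_block n (F \<union> H) (B j)" if "j \<in> insert i I" for j
    using that has_block_Un_self[OF H(2,3) _ FH, of "B i"] has_block_Un[OF _ FH] F(3) H(1) by blast
  ultimately show ?case using F(1) H(2) by blast
qed

section \<open>Filling gaps\<close>

text \<open>Finiteness prevents new limit points, and emptiness below non-limits protects the sets
  singled out by \<open>right_chi\<close>.\<close>

locale gap_filling =
  fixes \<kappa> :: "'o::wellorder" and G :: "'o \<Rightarrow> 'o \<Rightarrow> 'o set"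
  assumes finite_G: "finite (G \<beta> \<gamma>)"
    and G_subset: "G \<beta> \<gamma> \<subseteq> {\<gamma><..<\<beta>}"
    and G_limit: "G \<beta> \<gamma> \<noteq> {} \<Longrightarrow> \<beta> \<in> acc {..<\<kappa>}"
begin

section \<open>The filled set, its limit points and its order type\<close>

definition fill :: "'o set \<Rightarrow> 'o set" where
  "fill C = C \<union> {x. \<exists>\<gamma> \<beta>. gap C \<gamma> \<beta> \<and> x \<in> G \<beta> \<gamma>}"

lemma fill_cases:
  assumes "x \<in> fill C"
  obtains "x \<in> C" | \<gamma> \<beta> where "gap C \<gamma> \<beta>" "x \<in> G \<beta> \<gamma>" "\<gamma> < x" "x < \<beta>"
proof -
  have "\<gamma> < x \<and> x < \<beta>" if "x \<in> G \<beta> \<gamma>" for \<gamma> \<beta> using G_subset[of \<beta> \<gamma>] that by auto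
  with assms that show ?thesis unfolding fill_def by blast
qed

lemma subset_fill: "C \<subseteq> fill C" by (auto simp: fill_def)

text \<open>Two gaps whose interiors share a point have the same endpoints, so no other gap
  contributes points here.\<close>

lemma fill_gap:
  assumes "gap C \<gamma> \<beta>" shows "fill C \<inter> {\<gamma><..<\<beta>} = G \<beta> \<gamma>"
proof
  show "G \<beta> \<gamma> \<subseteq> fill C \<inter> {\<gamma><..<\<beta>}" using assms G_subset by (auto simp: fill_def)
  show "fill C \<inter> {\<gamma><..<\<beta>} \<subseteq> G \<beta> \<gamma>"
  proof
    fix x assume x: "x \<in> fill C \<inter> {\<gamma><..<\<beta>}"
    then have "x \<in> fill C" by blast
    then show "x \<in> G \<beta> \<gamma>"
    proof (cases rule: fill_cases)
      case 1
      with x assms show ?thesis by (auto simp: gap_def)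
    next
      case (2 \<gamma>' \<beta>')
      have mem: "\<gamma> \<in> C" "\<beta> \<in> C" "\<gamma>' \<in> C" "\<beta>' \<in> C" using assms 2 by (auto simp: gap_def)
      have "\<gamma>' \<le> \<gamma>" "\<beta> \<le> \<beta>'" "\<gamma> \<le> \<gamma>'" "\<beta>' \<le> \<beta>"
        using gap_left[OF assms mem(3)] gap_right[OF assms mem(4)]
          gap_left[OF 2(1) mem(1)] gap_right[OF 2(1) mem(2)] 2 x by auto
      with 2 show ?thesis by simp
    qed
  qed
qed

text \<open>If \<open>C\<close> has no points between some \<epsilon> and \<delta>, then an inserted
  point \<open>x\<close> there comes from a gap that covers everything from \<open>x\<close> up to
  \<delta>. That gap receives finitely many points, whereas a limit point needs infinitely
  many.\<close>

lemma limit_point_fill: "limit_point (fill C) \<delta> \<longleftrightarrow> limit_point C \<delta>"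
proof
  assume "limit_point C \<delta>"
  then show "limit_point (fill C) \<delta>" using subset_fill unfolding limit_point_def by (meson subsetD)
next
  assume L: "limit_point (fill C) \<delta>"
  show "limit_point C \<delta>"
  proof (rule ccontr)
    assume "\<not> limit_point C \<delta>"
    then obtain \<epsilon> where \<epsilon>: "\<epsilon> < \<delta>" "\<And>x. x \<in> C \<Longrightarrow> \<epsilon> < x \<Longrightarrow> \<not> x < \<delta>"
      using L unfolding limit_point_def by blast
    obtain x where x: "x \<in> fill C" "\<epsilon> < x" "x < \<delta>" using L \<epsilon>(1) unfolding limit_point_def by blast
    from x(1) show False
    proof (cases rule: fill_cases)
      case 1
      with \<epsilon>(2) x show False by blast
    next
      case (2 \<gamma> \<beta>)
      have "\<beta> \<in> C" "\<gamma> \<in> C" using 2 by (auto simp: gap_def)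
      then have "\<delta> \<le> \<beta>" "\<gamma> \<le> \<epsilon>"
        using \<epsilon>(2)[of \<beta>] \<epsilon>(2)[of \<gamma>] 2 x by (auto simp: not_less) (meson not_le order_less_trans)
      then have "fill C \<inter> {x..<\<delta>} \<subseteq> fill C \<inter> {\<gamma><..<\<beta>}" using 2 by auto
      then have "finite (fill C \<inter> {x..<\<delta>})"
        using fill_gap[OF 2(1)] finite_G finite_subset by metis
      with limit_point_infinite[OF L x(3)] show False ..
    qed
  qed
qed

lemma unbounded_closed_fill:
  assumes "unbounded_closed C \<alpha>" shows "unbounded_closed (fill C) \<alpha>"
proof -
  have "x < \<alpha>" if "x \<in> fill C" for x
    using that
  proof (cases rule: fill_cases)
    case 1
    with assms show ?thesis by (auto simp: unbounded_closed_def)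
  next
    case (2 \<gamma> \<beta>)
    then have "\<beta> < \<alpha>" using assms by (auto simp: unbounded_closed_def gap_def)
    with 2 show ?thesis by simp
  qed
  moreover have "fill C \<noteq> {}" "\<forall>\<epsilon><\<alpha>. \<exists>a\<in>fill C. \<epsilon> < a"
    "\<forall>\<delta><\<alpha>. limit_point (fill C) \<delta> \<longrightarrow> \<delta> \<in> fill C"
    using assms subset_fill[of C] unfolding limit_point_fill unbounded_closed_def by blast+
  ultimately show ?thesis by (auto simp: unbounded_closed_def)
qed

lemma osup_fill: "unbounded_closed C \<alpha> \<Longrightarrow> osup (fill C) = \<alpha>"
  by (intro unbounded_closed_imp_osup unbounded_closed_fill)

lemma acc_fill:
  assumes "unbounded_closed C \<alpha>" shows "acc (fill C) = acc C"
proof -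
  have "x \<in> C" if "x \<in> fill C" "limit_point C x" for x
    using unbounded_closed_fill[OF assms] assms that by (auto simp: unbounded_closed_def)
  then show ?thesis using subset_fill by (auto simp: acc_eq limit_point_fill)
qed

lemma otp_fill_le: "unbounded_closed C \<alpha> \<Longrightarrow> otp (fill C) \<le> otp C"
  using otp_le_of_acc_subset[of C \<alpha> "fill C"] unbounded_closed_fill acc_fill by blast

section \<open>Preservation of the relations in \<open>FF\<close>\<close>

text \<open>The anchor \<open>c\<close> lies in both sets, so a gap containing or ending beyond
  \<open>x \<ge> c\<close> among its inserted points starts at or after \<open>c\<close>, where the
  two sets agree below \<alpha>.\<close>

lemma fill_agree:
  assumes C: "unbounded_closed C \<alpha>" and "c \<in> C"
    and agree: "\<And>x. c \<le> x \<Longrightarrow> x \<in> C \<longleftrightarrow> x \<in> D \<and> x < \<alpha>" and "c \<le> x"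
  shows "x \<in> fill C \<longleftrightarrow> x \<in> fill D \<and> x < \<alpha>"
proof
  have C\<alpha>: "y < \<alpha>" if "y \<in> C" for y using that C by (auto simp: unbounded_closed_def)
  have "c \<in> D" using agree \<open>c \<in> C\<close> by blast
  {
    assume "x \<in> fill C"
    then show "x \<in> fill D \<and> x < \<alpha>"
    proof (cases rule: fill_cases)
      case 1
      with agree \<open>c \<le> x\<close> subset_fill show ?thesis by blast
    next
      case (2 \<gamma> \<beta>)
      have "c < \<beta>" using 2 \<open>c \<le> x\<close> by simp
      then have "c \<le> \<gamma>" using gap_left[OF 2(1) \<open>c \<in> C\<close>] by simp
      have \<beta>: "\<beta> < \<alpha>" using 2 C\<alpha> by (simp add: gap_def)
      have "y \<in> C" if "y \<in> D" "\<gamma> < y" "y < \<beta>" for y using agree[of y] that \<beta> \<open>c \<le> \<gamma>\<close> by auto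
      moreover have "\<gamma> \<in> D" "\<beta> \<in> D" using agree \<open>c \<le> \<gamma>\<close> \<open>c < \<beta>\<close> 2 by (auto simp: gap_def)
      ultimately have "gap D \<gamma> \<beta>" using 2(1) unfolding gap_def by (metis disjoint_iff greaterThanLessThan_iff)
      with 2 \<beta> show ?thesis by (auto simp: fill_def)
    qed
  }
  {
    assume x: "x \<in> fill D \<and> x < \<alpha>"
    then have "x \<in> fill D" ..
    then show "x \<in> fill C"
    proof (cases rule: fill_cases)
      case 1
      with agree \<open>c \<le> x\<close> x subset_fill show ?thesis by blast
    next
      case (2 \<gamma> \<beta>)
      have "c < \<beta>" using 2 \<open>c \<le> x\<close> by simp
      then have "c \<le> \<gamma>" using gap_left[OF 2(1) \<open>c \<in> D\<close>] by simp
      have "\<gamma> < \<alpha>" using 2 x by auto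
      \<comment> \<open>As \<open>C\<close> is unbounded in \<alpha>, a gap of \<open>D\<close> that
        starts below \<alpha> also ends below \<alpha>.\<close>
      then obtain a where a: "a \<in> C" "\<gamma> < a" by (rule unbounded_closed_exists[OF C])
      then have "a \<in> D" using agree[of a] \<open>c \<le> \<gamma>\<close> by auto
      then have "\<beta> \<le> a" using gap_right[OF 2(1)] a by blast
      then have "\<beta> < \<alpha>" using C\<alpha>[OF a(1)] by simp
      have "\<gamma> \<in> C" "\<beta> \<in> C"
        using agree \<open>c \<le> \<gamma>\<close> \<open>c < \<beta>\<close> \<open>\<gamma> < \<alpha>\<close> \<open>\<beta> < \<alpha>\<close> 2(1) by (auto simp: gap_def)
      moreover have "y \<in> D" if "y \<in> C" "\<gamma> < y" for y using agree[of y] that \<open>c \<le> \<gamma>\<close> by auto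
      ultimately have "gap C \<gamma> \<beta>" using 2(1) unfolding gap_def by (metis disjoint_iff greaterThanLessThan_iff)
      with 2 show ?thesis by (auto simp: fill_def)
    qed
  }
qed

lemma fill_ge:
  assumes "\<And>y. y \<in> C \<Longrightarrow> c \<le> y" "x \<in> fill C" shows "c \<le> x"
  using assms(2)
proof (cases rule: fill_cases)
  case (2 \<gamma> \<beta>)
  then have "c \<le> \<gamma>" using assms(1) by (simp add: gap_def)
  with 2 show ?thesis by simp
qed (rule assms(1))

text \<open>The anchor is the least element of \<open>C\<close>. It is also a lower bound of
  \<open>D\<close>, so neither filled set has points below it.\<close>

lemma end_ext_fill:
  assumes C: "unbounded_closed C \<alpha>" and "end_ext C D"
  shows "end_ext (fill C) (fill D)"
proof -
  have CD: "C = D \<inter> {..<\<alpha>}" using assms by (simp add: end_ext_def unbounded_closed_imp_osup)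
  define c where "c = (LEAST x. x \<in> C)"
  have "\<exists>x. x \<in> C" using C by (auto simp: unbounded_closed_def)
  then have c: "c \<in> C" unfolding c_def by (rule LeastI_ex)
  then have "c < \<alpha>" using CD by blast
  have leC: "c \<le> y" if "y \<in> C" for y unfolding c_def using that by (rule Least_le)
  have leD: "c \<le> y" if "y \<in> D" for y
    using leC[of y] CD that \<open>c < \<alpha>\<close> by (cases "y < \<alpha>") auto
  have "x \<in> fill C \<longleftrightarrow> x \<in> fill D \<and> x < \<alpha>" if "c \<le> x" for x
    by (rule fill_agree[OF C c _ that]) (use CD in blast)
  then have "fill C = fill D \<inter> {..<\<alpha>}" using fill_ge[OF leC] fill_ge[OF leD] by blast
  then show ?thesis unfolding end_ext_def osup_fill[OF C] .
qed

lemma osup_Diff_lessThan: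
  assumes "unbounded_closed C \<alpha>" "\<gamma> < \<alpha>"
  shows "osup (C - {..<\<gamma>}) = \<alpha>"
proof (subst osup_eq_iff)
  show "C - {..<\<gamma>} \<subseteq> {..\<alpha>}" using assms by (auto simp: unbounded_closed_def)
  show "\<forall>\<epsilon><\<alpha>. \<exists>x\<in>C - {..<\<gamma>}. \<epsilon> < x"
  proof (intro allI impI)
    fix \<epsilon> assume "\<epsilon> < \<alpha>"
    then have "max \<epsilon> \<gamma> < \<alpha>" using assms by simp
    then obtain a where "a \<in> C" "max \<epsilon> \<gamma> < a" by (rule unbounded_closed_exists[OF assms(1)])
    then show "\<exists>x\<in>C - {..<\<gamma>}. \<epsilon> < x" by (intro bexI[of _ a]) auto
  qed
qed

text \<open>The threshold moves up to an element \<open>c\<close> of \<open>C\<close>, because a gap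
  straddling the old threshold may differ in \<open>C\<close> and \<open>D\<close>.\<close>

lemma end_ext_star_fill:
  assumes C: "unbounded_closed C \<alpha>" and "end_ext_star C D"
  shows "end_ext_star (fill C) (fill D)"
proof -
  obtain \<gamma> where \<gamma>: "\<gamma> < \<alpha>" "C - {..<\<gamma>} = (D - {..<\<gamma>}) \<inter> {..<\<alpha>}"
    using assms(2) osup_Diff_lessThan[OF C]
    by (auto simp: end_ext_star_def end_ext_def unbounded_closed_imp_osup[OF C])
  obtain c where c: "c \<in> C" "\<gamma> < c" by (rule unbounded_closed_exists[OF C \<gamma>(1)])
  have "c < \<alpha>" using C c by (auto simp: unbounded_closed_def)
  have "x \<in> C \<longleftrightarrow> x \<in> D \<and> x < \<alpha>" if "c \<le> x" for x
  proof -
    have "x \<notin> {..<\<gamma>}" using c(2) that by auto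
    with \<gamma>(2) show ?thesis by blast
  qed
  then have "x \<in> fill C \<longleftrightarrow> x \<in> fill D \<and> x < \<alpha>" if "c \<le> x" for x
    using fill_agree[OF C c(1) _ that] by blast
  then have "fill C - {..<c} = (fill D - {..<c}) \<inter> {..<\<alpha>}" by (auto simp: not_less)
  moreover have "osup (fill C - {..<c}) = \<alpha>"
    by (rule osup_Diff_lessThan[OF unbounded_closed_fill[OF C] \<open>c < \<alpha>\<close>])
  ultimately have "end_ext (fill C - {..<c}) (fill D - {..<c})" by (simp add: end_ext_def)
  then show ?thesis unfolding end_ext_star_def osup_fill[OF C] using \<open>c < \<alpha>\<close> by blast
qed

text \<open>The right end of a gap is in \<open>nacc C\<close>, hence a successor, and
  \<open>G\<close> inserts points only below limits.\<close>

lemma fill_eq_self: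
  assumes "\<forall>\<beta>\<in>nacc C. is_succ \<beta>" shows "fill C = C"
proof -
  have "G \<beta> \<gamma> = {}" if gap: "gap C \<gamma> \<beta>" for \<gamma> \<beta>
  proof -
    have "\<gamma> < \<beta>" "\<beta> \<in> C" using gap by (simp_all add: gap_def)
    then have "\<not> limit_point C \<beta>" using gap_left[OF gap] unfolding limit_point_def by (meson leD)
    with \<open>\<beta> \<in> C\<close> have "\<beta> \<in> nacc C" by (simp add: nacc_def acc_eq)
    then have "is_succ \<beta>" using assms by blast
    then obtain \<eta> where "\<eta> < \<beta>" "\<beta> = osucc \<eta>" unfolding is_succ_def by blast
    then have "\<not> limit_point {..<\<kappa>} \<beta>" using osucc_not_limit_point by metis
    then have "\<beta> \<notin> acc {..<\<kappa>}" by (simp add: acc_eq)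
    then show ?thesis using G_limit by blast
  qed
  then show ?thesis unfolding fill_def by blast
qed

text \<open>The extra conditions in \<open>left_chi\<close> and \<open>omit\<close> depend only on
  \<open>osup C\<close>, which is unchanged. Under the second alternative of
  \<open>right_chi\<close>, the set \<open>D\<close> itself is unchanged.\<close>

lemma FF_fill:
  assumes "R \<in> FF" "unbounded_closed C \<alpha>" "R C D"
  shows "R (fill C) (fill D)"
proof -
  note ext = end_ext_fill[OF assms(2), of D] end_ext_star_fill[OF assms(2), of D]
  have osup: "osup (fill C) = osup C"
    using osup_fill[OF assms(2)] unbounded_closed_imp_osup[OF assms(2)] by simp
  show ?thesis
    using assms(1,3)
  proof induction
    case (5 \<chi>)
    then show ?case using ext fill_eq_self[of D] unfolding right_chi_def by (elim disjE) simp_all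
  next
    case (6 \<chi>)
    then show ?case using ext fill_eq_self[of D] unfolding right_chi_def by (elim disjE) simp_all
  qed (use ext in \<open>simp_all add: left_chi_def omit_def osup, blast+\<close>)
qed

section \<open>From hits to blocks\<close>

text \<open>Starting at \<open>Min H\<close>, the first \<open>card {..<\<sigma>} + 1\<close>
  elements of the filled set are exactly those of \<open>H\<close>, and \<open>succ_set\<close>
  looks no further.\<close>

lemma fill_block:
  assumes C: "unbounded_closed C \<alpha>" and gap: "gap C \<gamma> \<beta>"
    and block: "has_block (card {..<\<sigma>}) (G \<beta> \<gamma>) B" and fin: "finite {..<\<sigma>}"
  shows "\<exists>\<gamma>'\<in>fill C. \<gamma> < \<gamma>' \<and> succ_set \<sigma> (fill C - {..<\<gamma>'}) \<subseteq> B"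
proof -
  obtain H where H: "H \<subseteq> G \<beta> \<gamma>" "H \<subseteq> B" "finite H" "card H = Suc (card {..<\<sigma>})"
    and conv: "\<And>x. x \<in> G \<beta> \<gamma> \<Longrightarrow> Min H \<le> x \<Longrightarrow> x \<le> Max H \<Longrightarrow> x \<in> H"
    using block unfolding has_block_def by (metis le_inf_iff)
  have "H \<noteq> {}" using H(4) by auto
  note G = fill_gap[OF gap]
  define E where "E = fill C - {..<Min H}"
  have "\<not> x < Min H" if "x \<in> H" for x using Min_le[OF H(3) that] by (rule leD)
  then have HE: "H \<subseteq> E" using H(1) G unfolding E_def by blast
  have mem: "Min H \<in> G \<beta> \<gamma>" "Max H \<in> G \<beta> \<gamma>" using \<open>H \<noteq> {}\<close> H Min_in Max_in by blast+
  have "x \<in> H" if x: "x \<in> succ_set \<sigma> E" for x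
  proof (rule ccontr)
    assume "x \<notin> H"
    have "E \<subseteq> {..<\<alpha>}" using unbounded_closed_fill[OF C] unfolding unbounded_closed_def E_def by blast
    note card = succ_set_card[OF this x fin]
    have "Max H < x"
    proof (rule ccontr)
      assume "\<not> Max H < x"
      then have le: "x \<le> Max H" "Min H \<le> x" using card(1) by (simp_all add: E_def not_less)
      have "\<gamma> < Min H" "Max H < \<beta>" using mem G_subset[of \<beta> \<gamma>] by auto
      then have "x \<in> fill C \<inter> {\<gamma><..<\<beta>}" using le card(1) by (auto simp: E_def)
      with G conv le \<open>x \<notin> H\<close> show False by blast
    qed
    \<comment> \<open>Lying above \<open>Max H\<close>, the point \<open>x\<close> has all of
      \<open>H\<close> below it, which is one element too many.\<close>
    then have "y < x" if "y \<in> H" for y using Max_ge[OF H(3) that] by simp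
    then have "H \<subseteq> E \<inter> {..<x}" using HE by blast
    then have "card H \<le> card (E \<inter> {..<x})" using card(2) card_mono by blast
    with card(3) H(4) show False by simp
  qed
  then have "succ_set \<sigma> E \<subseteq> B" using H(2) by blast
  moreover have "Min H \<in> fill C \<inter> {\<gamma><..<\<beta>}" using mem(1) unfolding G .
  then have "Min H \<in> fill C" "\<gamma> < Min H" by auto
  ultimately show ?thesis unfolding E_def by blast
qed

text \<open>A hit at \<gamma> puts the next element \<beta> of \<open>C\<close> into
  \<open>A\<close>, so \<open>G \<beta> \<gamma>\<close> contains a block for \<open>B\<close>. The
  new witness is the start of that block, above \<gamma>.\<close>

lemma fill_hits:
  assumes C: "unbounded_closed C \<alpha>" and fin: "finite {..<\<sigma>}"
    and hit: "osup {\<gamma> \<in> C. succ_set oone (C - {..<\<gamma>}) \<subseteq> A} = \<alpha>"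
    and blocks: "\<And>\<beta> \<gamma>. \<beta> \<in> A \<Longrightarrow> \<gamma> < \<beta> \<Longrightarrow> has_block (card {..<\<sigma>}) (G \<beta> \<gamma>) B"
  shows "osup {\<gamma> \<in> fill C. succ_set \<sigma> (fill C - {..<\<gamma>}) \<subseteq> B} = \<alpha>"
proof (subst osup_eq_iff)
  show "{\<gamma> \<in> fill C. succ_set \<sigma> (fill C - {..<\<gamma>}) \<subseteq> B} \<subseteq> {..\<alpha>}"
    using unbounded_closed_fill[OF C] by (auto simp: unbounded_closed_def)
  show "\<forall>\<epsilon><\<alpha>. \<exists>x\<in>{\<gamma> \<in> fill C. succ_set \<sigma> (fill C - {..<\<gamma>}) \<subseteq> B}. \<epsilon> < x"
  proof (intro allI impI)
    fix \<epsilon> assume "\<epsilon> < \<alpha>"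
    have C\<alpha>: "C \<subseteq> {..<\<alpha>}" using C by (simp add: unbounded_closed_def)
    then have "{\<gamma> \<in> C. succ_set oone (C - {..<\<gamma>}) \<subseteq> A} \<subseteq> {..\<alpha>}" by auto
    then obtain \<gamma> where \<gamma>: "\<gamma> \<in> C" "succ_set oone (C - {..<\<gamma>}) \<subseteq> A" "\<epsilon> < \<gamma>"
      using hit \<open>\<epsilon> < \<alpha>\<close> osup_eq_iff by blast
    then have "\<gamma> < \<alpha>" using C\<alpha> by blast
    then obtain a where "a \<in> C" "\<gamma> < a" by (rule unbounded_closed_exists[OF C])
    then obtain \<beta> where \<beta>: "gap C \<gamma> \<beta>" using gap_exists \<gamma>(1) by blast
    then have "\<beta> \<in> A" "\<gamma> < \<beta>" using succ_set_oone[OF C\<alpha>, of \<gamma> \<beta>] \<gamma>(2) by (auto simp: gap_def)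
    from fill_block[OF C \<beta> blocks[OF this] fin]
    obtain \<gamma>' where "\<gamma>' \<in> fill C" "\<gamma> < \<gamma>'" "succ_set \<sigma> (fill C - {..<\<gamma>'}) \<subseteq> B" by blast
    moreover have "\<epsilon> < \<gamma>'" using \<gamma>(3) \<open>\<gamma> < \<gamma>'\<close> by (rule less_trans)
    ultimately show "\<exists>x\<in>{\<gamma> \<in> fill C. succ_set \<sigma> (fill C - {..<\<gamma>}) \<subseteq> B}. \<epsilon> < x" by blast
  qed
qed

lemma fill_trivial: "fill {} = {}" "fill {a} = {a}"
  by (auto simp: fill_def gap_def)

section \<open>Coherence and hitting for the filled sequence\<close>

lemma P_coherent_fill:
  assumes coh: "P_coherent \<xi> \<kappa> \<mu> R \<C>" and "R \<in> FF"
  shows "P_coherent \<xi> \<kappa> \<mu> R (\<lambda>\<alpha>. fill ` \<C> \<alpha>)"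
proof -
  have c0: "\<C> ozero = {{}}" and c1: "\<And>\<alpha>. \<alpha> < \<kappa> \<Longrightarrow> \<C> (osucc \<alpha>) = {{\<alpha>}}"
    and lim: "\<And>\<alpha>. \<alpha> \<in> acc {..<\<kappa>} \<Longrightarrow> \<C> \<alpha> \<subseteq> {C \<in> KK \<kappa>. otp C \<le> \<xi> \<and> osup C = \<alpha>} \<and>
        \<C> \<alpha> \<noteq> {} \<and> card_bound \<mu> \<alpha> (\<C> \<alpha>) \<and> (\<forall>C\<in>\<C> \<alpha>. \<forall>\<alpha>'\<in>acc C. \<exists>D\<in>\<C> \<alpha>'. R D C)"
    using coh unfolding P_coherent_def by simp_all
  have *: "C \<subseteq> {..<\<kappa>}" "unbounded_closed C \<alpha>" "otp C \<le> \<xi>" if "\<alpha> \<in> acc {..<\<kappa>}" "C \<in> \<C> \<alpha>" for C \<alpha>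
  proof -
    have "C \<in> KK \<kappa> \<and> osup C = \<alpha>" "otp C \<le> \<xi>" using lim[OF that(1)] that(2) by blast+
    then show "C \<subseteq> {..<\<kappa>}" "unbounded_closed C \<alpha>" "otp C \<le> \<xi>" unfolding KK_iff by simp_all
  qed
  show ?thesis
    unfolding P_coherent_def
  proof (intro conjI allI impI ballI)
    show "fill ` \<C> ozero = {{}}" unfolding c0 by (simp add: fill_trivial)
    show "fill ` \<C> (osucc \<alpha>) = {{\<alpha>}}" if "\<alpha> < \<kappa>" for \<alpha> unfolding c1[OF that] by (simp add: fill_trivial)
    fix \<alpha> assume \<alpha>: "\<alpha> \<in> acc {..<\<kappa>}"
    then have "\<alpha> < \<kappa>" by (simp add: acc_eq)
    show "fill ` \<C> \<alpha> \<subseteq> {C \<in> KK \<kappa>. otp C \<le> \<xi> \<and> osup C = \<alpha>}"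
    proof clarify
      fix C assume "C \<in> \<C> \<alpha>"
      note C = *[OF \<alpha> this]
      have "fill C \<subseteq> {..<\<alpha>}" using unbounded_closed_fill[OF C(2)] by (simp add: unbounded_closed_def)
      then have "fill C \<subseteq> {..<\<kappa>}" using \<open>\<alpha> < \<kappa>\<close> by auto
      then have "fill C \<in> KK \<kappa> \<and> osup (fill C) = \<alpha>"
        unfolding KK_iff using unbounded_closed_fill[OF C(2)] by simp
      moreover have "otp (fill C) \<le> \<xi>" using otp_fill_le[OF C(2)] C(3) by (rule order_trans)
      ultimately show "fill C \<in> KK \<kappa> \<and> otp (fill C) \<le> \<xi> \<and> osup (fill C) = \<alpha>" by blast
    qed
    show "fill ` \<C> \<alpha> \<noteq> {}" using lim[OF \<alpha>] by simp
    have "card_bound \<mu> \<alpha> (\<C> \<alpha>)" using lim[OF \<alpha>] by simp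
    then show "card_bound \<mu> \<alpha> (fill ` \<C> \<alpha>)"
      unfolding card_bound_def using lepoll_trans[OF image_lepoll] lesspoll_trans1[OF image_lepoll]
      by (cases \<mu>) simp_all
    fix C' \<alpha>' assume "C' \<in> fill ` \<C> \<alpha>" and \<alpha>': "\<alpha>' \<in> acc C'"
    then obtain C where C: "C \<in> \<C> \<alpha>" "C' = fill C" by blast
    note C1 = *[OF \<alpha> C(1)]
    have "\<alpha>' \<in> acc C" using \<alpha>' acc_fill[OF C1(2)] C(2) by simp
    then obtain D where D: "D \<in> \<C> \<alpha>'" "R D C" using lim[OF \<alpha>] C(1) by blast
    \<comment> \<open>This makes \<open>D\<close> closed and unbounded in \<open>\<alpha>'\<close>,
      as coherence prescribes at limit ordinals.\<close>
    have "\<alpha>' \<in> acc {..<\<kappa>}" using \<open>\<alpha>' \<in> acc C\<close> C1(1) unfolding acc_eq limit_point_def by blast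
    then have "R (fill D) (fill C)" using FF_fill[OF assms(2) *(2)] D by blast
    then show "\<exists>D\<in>fill ` \<C> \<alpha>'. R D C'" using D C(2) by blast
  qed
qed

text \<open>
  The requirement \<open>i \<le> i'\<close> ensures that \<open>i < min \<alpha> \<theta>\<close> whenever \<open>i' < min \<alpha> \<theta>'\<close>.
\<close>

lemma P_hits_fill:
  assumes S: "\<forall>S\<in>\<S>. stationary_in S \<kappa>" and coh: "P_coherent \<xi> \<kappa> \<mu> R \<C>"
    and hits: "P_hits \<kappa> \<theta> \<S> \<nu> oone \<C>" and fin: "finite {..<\<sigma>}"
    and A: "\<And>B. (\<forall>i<\<theta>'. cofinal_in (B i) \<kappa>) \<Longrightarrow> \<exists>A. (\<forall>i<\<theta>. cofinal_in (A i) \<kappa>) \<and>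
      (\<forall>i'<\<theta>'. \<exists>i<\<theta>. i \<le> i' \<and> (\<forall>\<beta>\<in>A i. \<forall>\<gamma><\<beta>. has_block (card {..<\<sigma>}) (G \<beta> \<gamma>) (B i')))"
  shows "P_hits \<kappa> \<theta>' \<S> \<nu> \<sigma> (\<lambda>\<alpha>. fill ` \<C> \<alpha>)"
  unfolding P_hits_def
proof (intro allI impI ballI)
  fix B S assume "\<forall>i<\<theta>'. cofinal_in (B i) \<kappa>" and "S \<in> \<S>"
  then obtain A where "\<forall>i<\<theta>. cofinal_in (A i) \<kappa>" and
    AB: "\<And>i'. i' < \<theta>' \<Longrightarrow> \<exists>i<\<theta>. i \<le> i' \<and> (\<forall>\<beta>\<in>A i. \<forall>\<gamma><\<beta>. has_block (card {..<\<sigma>}) (G \<beta> \<gamma>) (B i'))"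
    using A by blast
  let ?old = "{\<alpha> \<in> S. \<C> \<alpha> \<prec> {..<\<nu>} \<and> (\<forall>C\<in>\<C> \<alpha>. \<forall>i<min \<alpha> \<theta>.
     osup {\<gamma> \<in> C. succ_set oone (C - {..<\<gamma>}) \<subseteq> A i} = \<alpha>)}"
  let ?new = "{\<alpha> \<in> S. fill ` \<C> \<alpha> \<prec> {..<\<nu>} \<and> (\<forall>C\<in>fill ` \<C> \<alpha>. \<forall>i<min \<alpha> \<theta>'.
     osup {\<gamma> \<in> C. succ_set \<sigma> (C - {..<\<gamma>}) \<subseteq> B i} = \<alpha>)}"
  have old: "stationary_in ?old \<kappa>"
    using hits \<open>\<forall>i<\<theta>. cofinal_in (A i) \<kappa>\<close> \<open>S \<in> \<S>\<close> unfolding P_hits_def by blast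
  then have old_le: "?old \<subseteq> {..<\<kappa>}" unfolding stationary_in_def by blast
  have old_new: "\<alpha> \<in> ?new" if \<alpha>: "\<alpha> \<in> ?old" for \<alpha>
  proof -
    have "\<alpha> < \<kappa>" using old_le \<alpha> by blast
    have "osup {\<gamma> \<in> fill C. succ_set \<sigma> (fill C - {..<\<gamma>}) \<subseteq> B i'} = \<alpha>"
      if C: "C \<in> \<C> \<alpha>" and i': "i' < \<alpha>" "i' < \<theta>'" for C i'
    proof -
      obtain i where i: "i < \<theta>" "i \<le> i'"
        and blocks: "\<And>\<beta> \<gamma>. \<beta> \<in> A i \<Longrightarrow> \<gamma> < \<beta> \<Longrightarrow> has_block (card {..<\<sigma>}) (G \<beta> \<gamma>) (B i')"
        using AB[OF i'(2)] by blast
      have "i < min \<alpha> \<theta>" using i i' by simp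
      then have hit: "osup {\<gamma> \<in> C. succ_set oone (C - {..<\<gamma>}) \<subseteq> A i} = \<alpha>" using \<alpha> C by blast
      from \<open>\<alpha> < \<kappa>\<close> show ?thesis
      \<comment> \<open>Since \<open>S\<close> may contain non-limits, these are treated separately:
        at zero no index \<open>i'\<close> remains, and at a successor the only set is a singleton,
        whose supremum is too small for the assumed hit.\<close>
      proof (cases rule: limit_cases)
        case 1
        with i'(1) ozero_le[of i'] show ?thesis using leD by blast
      next
        case (2 \<eta>)
        then have "C = {\<eta>}" using coh C \<open>\<alpha> < \<kappa>\<close> unfolding P_coherent_def by (metis order_less_trans singletonD)
        then have "{\<gamma> \<in> C. succ_set oone (C - {..<\<gamma>}) \<subseteq> A i} \<subseteq> {..\<eta>}" by auto
        then have "osup {\<gamma> \<in> C. succ_set oone (C - {..<\<gamma>}) \<subseteq> A i} \<le> \<eta>"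
          unfolding osup_def by (intro Least_le) auto
        with hit 2(1) show ?thesis by simp
      next
        case 3
        then have "unbounded_closed C \<alpha>"
          using coh C KK_iff[of C \<kappa> \<alpha>] unfolding P_coherent_def by blast
        then show ?thesis using fill_hits[OF _ fin hit blocks] by blast
      qed
    qed
    moreover have "fill ` \<C> \<alpha> \<prec> {..<\<nu>}" using \<alpha> image_lepoll lesspoll_trans1 by blast
    ultimately show ?thesis using \<alpha> by auto
  qed
  have "S \<subseteq> {..<\<kappa>}" using S \<open>S \<in> \<S>\<close> by (simp add: stationary_in_def)
  then have "?new \<subseteq> {..<\<kappa>}" by blast
  moreover have "?old \<subseteq> ?new" using old_new by (rule subsetI)
  ultimately show "stationary_in ?new \<kappa>" using old unfolding stationary_in_def by (meson disjoint_iff subsetD)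
qed

end

section \<open>Both conclusions from the filled sequence\<close>

lemma less_omega_finite: "\<sigma> < omega \<Longrightarrow> finite {..<\<sigma>}"
  unfolding omega_def by (drule not_less_Least) simp

theorem theorem4p16:
  fixes \<kappa> \<xi> \<nu> \<theta> :: "'o::wellorder"
    and \<mu> :: "'o option"
    and \<S> :: "'o set set"
    and R :: "'o set \<Rightarrow> 'o set \<Rightarrow> bool"
  assumes "regular_uncountable \<kappa>"
    and "\<xi> \<le> \<kappa>"
    and "\<forall>m. \<mu> = Some m \<longrightarrow> is_cardinal m \<and> m \<le> \<kappa>"
    and "is_cardinal \<nu>" and "\<nu> \<le> \<kappa>"
    and "is_cardinal \<theta>" and "\<theta> \<le> \<kappa>"
    and "\<S> \<noteq> {}" and "\<forall>S\<in>\<S>. stationary_in S \<kappa>"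
    and "R \<in> FF"
    and "clubsuit_principle \<kappa>"
    and "P_minus \<xi> \<kappa> \<mu> R \<theta> \<S> \<nu> oone"
  shows "P_minus_fin_sigma \<xi> \<kappa> \<mu> R \<theta> \<S> \<nu> \<and>
         (ozero < \<theta> \<and> \<theta> < omega \<longrightarrow> P_minus_fin_theta_sigma \<xi> \<kappa> \<mu> R \<S> \<nu>)"
proof -
  obtain \<C> where coh: "P_coherent \<xi> \<kappa> \<mu> R \<C>" and hits: "P_hits \<kappa> \<theta> \<S> \<nu> oone \<C>"
    using assms(12) by (auto simp: P_minus_def)
  obtain G :: "'o \<Rightarrow> 'o \<Rightarrow> 'o set" where
    G: "\<And>\<beta> \<gamma>. finite (G \<beta> \<gamma>)" "\<And>\<beta> \<gamma>. G \<beta> \<gamma> \<subseteq> {\<gamma><..<\<beta>}"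
      "\<And>\<beta> \<gamma>. G \<beta> \<gamma> \<noteq> {} \<Longrightarrow> \<beta> \<in> acc {..<\<kappa>}"
    and guess: "\<And>\<F>. (\<forall>\<delta><\<kappa>. \<exists>F\<in>\<F>. finite F \<and> F \<subseteq> {\<delta><..<\<kappa>}) \<Longrightarrow>
       cofinal_in {\<beta> \<in> acc {..<\<kappa>}. \<forall>\<gamma><\<beta>. G \<beta> \<gamma> \<in> \<F>} \<kappa>"
    by (rule finite_set_guessing[OF assms(1,11)]) (rule that)
  interpret gap_filling \<kappa> G by unfold_locales (fact G)+
  \<comment> \<open>One guessed set can carry blocks for finitely many \<open>B i\<close> at once;
    this is what makes the passage to more cofinal sets possible.\<close>
  define good where "good I n B = {\<beta> \<in> acc {..<\<kappa>}. \<forall>\<gamma><\<beta>. G \<beta> \<gamma> \<in> {F. \<forall>i\<in>I. has_block n F (B i)}}"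
    for I :: "'o set" and n B
  have good_cofinal: "cofinal_in (good I n B) \<kappa>"
    if "finite I" "\<forall>i\<in>I. cofinal_in (B i) \<kappa>" for I n B
    unfolding good_def by (rule guess) (use blocks_exist[OF assms(1) that] in blast)
  have good_block: "has_block n (G \<beta> \<gamma>) (B i)" if "\<beta> \<in> good I n B" "\<gamma> < \<beta>" "i \<in> I" for I n B \<beta> \<gamma> i
    using that by (simp add: good_def)
  have "P_hits \<kappa> \<theta> \<S> \<nu> \<sigma> (\<lambda>\<alpha>. fill ` \<C> \<alpha>)" if "\<sigma> < omega" for \<sigma>
  proof (rule P_hits_fill[OF assms(9) coh hits less_omega_finite[OF that]])
    fix B assume B: "\<forall>i<\<theta>. cofinal_in (B i) \<kappa>"
    \<comment> \<open>Each \<open>B i\<close> gets its own set of good ordinals, with the same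
      index.\<close>
    define A where "A i = good {i} (card {..<\<sigma>}) B" for i
    have "\<forall>i<\<theta>. cofinal_in (A i) \<kappa>" using B unfolding A_def by (auto intro!: good_cofinal)
    moreover have "\<forall>\<beta>\<in>A i. \<forall>\<gamma><\<beta>. has_block (card {..<\<sigma>}) (G \<beta> \<gamma>) (B i)" for i
      unfolding A_def using good_block by blast
    ultimately show "\<exists>A. (\<forall>i<\<theta>. cofinal_in (A i) \<kappa>) \<and>
      (\<forall>i'<\<theta>. \<exists>i<\<theta>. i \<le> i' \<and> (\<forall>\<beta>\<in>A i. \<forall>\<gamma><\<beta>. has_block (card {..<\<sigma>}) (G \<beta> \<gamma>) (B i')))"
      by (meson order_refl)
  qed
  then have "P_minus_fin_sigma \<xi> \<kappa> \<mu> R \<theta> \<S> \<nu>"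
    unfolding P_minus_fin_sigma_def using P_coherent_fill[OF coh assms(10)] by blast
  moreover have "P_minus_fin_theta_sigma \<xi> \<kappa> \<mu> R \<S> \<nu>" if "ozero < \<theta>"
  proof -
    have "P_hits \<kappa> \<theta>' \<S> \<nu> \<sigma> (\<lambda>\<alpha>. fill ` \<C> \<alpha>)" if \<theta>': "\<theta>' < omega" and \<sigma>: "\<sigma> < omega" for \<theta>' \<sigma>
    proof (rule P_hits_fill[OF assms(9) coh hits less_omega_finite[OF \<sigma>]])
      fix B assume B: "\<forall>i<\<theta>'. cofinal_in (B i) \<kappa>"
      \<comment> \<open>A single set serves all \<open>B i'\<close> simultaneously, as
        \<open>{..<\<theta>'}\<close> is finite.\<close>
      define A where "A = good {..<\<theta>'} (card {..<\<sigma>}) B"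
      have "cofinal_in A \<kappa>" unfolding A_def using B less_omega_finite[OF \<theta>'] by (auto intro!: good_cofinal)
      moreover have "\<forall>\<beta>\<in>A. \<forall>\<gamma><\<beta>. has_block (card {..<\<sigma>}) (G \<beta> \<gamma>) (B i')" if "i' < \<theta>'" for i'
        unfolding A_def using good_block that by blast
      ultimately show "\<exists>A. (\<forall>i<\<theta>. cofinal_in (A i) \<kappa>) \<and>
        (\<forall>i'<\<theta>'. \<exists>i<\<theta>. i \<le> i' \<and> (\<forall>\<beta>\<in>A i. \<forall>\<gamma><\<beta>. has_block (card {..<\<sigma>}) (G \<beta> \<gamma>) (B i')))"
        \<comment> \<open>The constant sequence is used at index \<open>ozero\<close>, which is
          below \<theta> and at most every \<open>i'\<close>.\<close>
        using \<open>ozero < \<theta>\<close> ozero_le by (intro exI[of _ "\<lambda>_. A"]) blast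
    qed
    then show ?thesis
      unfolding P_minus_fin_theta_sigma_def using P_coherent_fill[OF coh assms(10)] by blast
  qed
  ultimately show ?thesis by blast
qed

end
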